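(* Let $(\Phi_n)_{n\in\mathbb{N}}$ be a sequence of entire functions of exponential type, and let $\Phi_0$ denote the constant function $1$. Assume that there exist positive real numbers $R_1, R_2, R_3$, $\alpha_{n,j}$ (for all integers $n > j \ge 0$) and $\beta_{n,j}$ (for all integers $n > j \ge 1$) satisfying the following conditions: (a) $\displaystyle \sup_{n \in \mathbb{N}} \sum_{j=0}^{n-1} \alpha_{n,j} < +\infty$ and $\displaystyle \sup_{j \in \mathbb{N}} \sum_{n=j+1}^{\infty} \beta_{n,j} < +\infty$. (b) $\Phi_n(t) \ne 0$ for all $t \in A(R_1,R_2,R_3)$ and all $n \in \mathbb{N}$. (c) $|\Phi_n(t)| \le \alpha_{n,j} |\Phi_j(t)|$ for all $t\in\mathbb{C}$ with $|t| = R_1$ and all $n > j \ge 0$. (d) $|\Phi_j(t)| \le \beta_{n,j} |\Phi_n(t)|$ for all $t\in\mathbb{C}$ with $|t| = R_2$ and all $n > j \ge 1$. (e) The series $\displaystyle \sum_{n=1}^{\infty} \frac{1}{\min_{|t| = R_3} |\Phi_n(t)|}$ converges. Then the sequence of differential operators $(\Phi_n(D))_{n\in\mathbb{N}}$ is frequently hypercyclic on $H(\mathbb{C})$.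
   Context: $\mathbb{N} = \{1,2,3,\dots\}$. $H(\mathbb{C})$ is the Fréchet space of all entire functions $\mathbb{C}\to\mathbb{C}$ with the topology of uniform convergence on compact sets. An entire function $\Phi$ is of exponential type if there are constants $A,B>0$ with $|\Phi(z)| \le A e^{B|z|}$ for all $z\in\mathbb{C}$. If $\Phi(z) = \sum_{k=0}^\infty a_k z^k$ is of exponential type, then $\Phi(D)$ denotes the continuous linear operator on $H(\mathbb{C})$ given by $(\Phi(D)f)(z) = \sum_{k=0}^\infty a_k f^{(k)}(z)$. For $R_1,\dots,R_p \in (0,+\infty)$, $A(R_1,\dots,R_p) := \{z\in\mathbb{C} : \rho \le |z| \le \sigma\}$, where $\rho = \min\{R_1,\dots,R_p\}$ and $\sigma = \max\{R_1,\dots,R_p\}$. The lower density of $S\subset\mathbb{N}$ is $\underline{\mathrm{dens}}(S) = \liminf_{n\to\infty} \frac{\mathrm{card}(S\cap\{1,\dots,n\})}{n}$. A sequence $(T_n)_{n\in\mathbb{N}}$ of continuous linear operators on a topological vector space $X$ is frequently hypercyclic if there is a vector $x_0\in X$ such that $\underline{\mathrm{dens}}(\{n\in\mathbb{N} : T_n x_0\in U\}) > 0$ for every nonempty open set $U\subset X$. *)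

theory Defs
  imports "HOL-Complex_Analysis.Complex_Analysis"
begin

definition entire_functions :: "(complex \<Rightarrow> complex) set" where
  "entire_functions = {f. f holomorphic_on UNIV}"

definition entire_topology :: "(complex \<Rightarrow> complex) topology" where
  "entire_topology = topology (\<lambda>U. U \<subseteq> entire_functions \<and>
     (\<forall>f\<in>U. \<exists>K e. compact K \<and> 0 < e \<and>
        {g \<in> entire_functions. \<forall>z\<in>K. dist (g z) (f z) < e} \<subseteq> U))"

lemma istopology_entire:
  "istopology (\<lambda>U. U \<subseteq> entire_functions \<and>
     (\<forall>f\<in>U. \<exists>K e. compact K \<and> 0 < e \<and>
        {g \<in> entire_functions. \<forall>z\<in>K. dist (g z) (f z) < e} \<subseteq> U))"
proof -
  define N where "N = (\<lambda>f K e. {g \<in> entire_functions. \<forall>z\<in>K. dist (g z) (f z) < (e::real)})"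
  have "istopology (\<lambda>U. U \<subseteq> entire_functions \<and>
     (\<forall>f\<in>U. \<exists>K e. compact K \<and> 0 < e \<and> N f K e \<subseteq> U))"
    unfolding istopology_def
  proof (intro conjI allI impI ballI)
    fix S T f
    assume S: "S \<subseteq> entire_functions \<and> (\<forall>f\<in>S. \<exists>K e. compact K \<and> 0 < e \<and> N f K e \<subseteq> S)"
      and T: "T \<subseteq> entire_functions \<and> (\<forall>f\<in>T. \<exists>K e. compact K \<and> 0 < e \<and> N f K e \<subseteq> T)"
      and f: "f \<in> S \<inter> T"
    from f S obtain K1 e1 where 1: "compact K1" "0 < e1" "N f K1 e1 \<subseteq> S" by (meson IntD1)
    from f T obtain K2 e2 where 2: "compact K2" "0 < e2" "N f K2 e2 \<subseteq> T" by (meson IntD2)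
    have "N f (K1 \<union> K2) (min e1 e2) \<subseteq> N f K1 e1" "N f (K1 \<union> K2) (min e1 e2) \<subseteq> N f K2 e2"
      by (auto simp: N_def)
    then have "N f (K1 \<union> K2) (min e1 e2) \<subseteq> S \<inter> T"
      using 1(3) 2(3) by (meson Int_greatest order_trans)
    moreover have "compact (K1 \<union> K2)" "0 < min e1 e2"
      using 1 2 by (auto intro: compact_Un)
    ultimately show "\<exists>K e. compact K \<and> 0 < e \<and> N f K e \<subseteq> S \<inter> T" by meson
  next
    fix \<K> f
    assume K: "\<forall>U\<in>\<K>. U \<subseteq> entire_functions \<and>
        (\<forall>f\<in>U. \<exists>K e. compact K \<and> 0 < e \<and> N f K e \<subseteq> U)"
      and "f \<in> \<Union>\<K>"
    then obtain U where U: "U \<in> \<K>" "f \<in> U" by (meson UnionE)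
    with K obtain K e where "compact K" "0 < e" "N f K e \<subseteq> U" by meson
    with U(1) show "\<exists>K e. compact K \<and> 0 < e \<and> N f K e \<subseteq> \<Union>\<K>"
      by (meson Union_upper order_trans)
  qed (auto dest: bspec)
  then show ?thesis by (simp only: N_def)
qed

lemma openin_entire_topology:
  "openin entire_topology U \<longleftrightarrow> U \<subseteq> entire_functions \<and>
     (\<forall>f\<in>U. \<exists>K e. compact K \<and> 0 < e \<and>
        {g \<in> entire_functions. \<forall>z\<in>K. dist (g z) (f z) < e} \<subseteq> U)"
  unfolding entire_topology_def topology_inverse'[OF istopology_entire] ..

lemma topspace_entire_topology [simp]: "topspace entire_topology = entire_functions"
proof
  show "topspace entire_topology \<subseteq> entire_functions"
    unfolding topspace_def openin_entire_topology by blast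
  have "openin entire_topology entire_functions"
    unfolding openin_entire_topology
    by (auto intro!: exI[of _ "{}"] exI[of _ "1::real"])
  then show "entire_functions \<subseteq> topspace entire_topology"
    by (rule openin_subset)
qed

definition exponential_type :: "(complex \<Rightarrow> complex) \<Rightarrow> bool" where
  "exponential_type \<Phi> \<longleftrightarrow> \<Phi> \<in> entire_functions \<and>
     (\<exists>A B. 0 < A \<and> 0 < B \<and> (\<forall>z. norm (\<Phi> z) \<le> A * exp (B * norm z)))"

definition diff_op :: "(complex \<Rightarrow> complex) \<Rightarrow> (complex \<Rightarrow> complex) \<Rightarrow> complex \<Rightarrow> complex" where
  "diff_op \<Phi> f z = (\<Sum>k. fps_nth (fps_expansion \<Phi> 0) k * (deriv ^^ k) f z)"

definition annulus :: "real set \<Rightarrow> complex set" where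
  "annulus R = {z. Min R \<le> norm z \<and> norm z \<le> Max R}"

text \<open>The value at \<open>n = 0\<close>, a division by zero, does not affect the limit inferior.\<close>
definition lower_density :: "nat set \<Rightarrow> ereal" where
  "lower_density S = liminf (\<lambda>n. ereal (real (card (S \<inter> {1..n})) / real n))"

text \<open>The sequence is \<open>T 1, T 2, \<dots>\<close>; the value \<open>T 0\<close> is irrelevant. For the operators
  \<^const>\<open>diff_op\<close> on \<^const>\<open>entire_topology\<close>, self-mapping, linearity and continuity are
  established below.\<close>
definition frequently_hypercyclic :: "'a topology \<Rightarrow> (nat \<Rightarrow> 'a \<Rightarrow> 'a) \<Rightarrow> bool" where
  "frequently_hypercyclic X T \<longleftrightarrow>
     (\<exists>x\<in>topspace X. \<forall>U. openin X U \<and> U \<noteq> {} \<longrightarrow> lower_density {n. 1 \<le> n \<and> T n x \<in> U} > 0)"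

lemma diff_op_term_bound:
  assumes "exponential_type \<Phi>"
  obtains C \<rho> where "0 < C" "0 < \<rho>"
    "\<And>f z M k. f \<in> entire_functions \<Longrightarrow> (\<And>w. w \<in> cball z \<rho> \<Longrightarrow> norm (f w) \<le> M) \<Longrightarrow>
       norm (fps_nth (fps_expansion \<Phi> 0) k * (deriv ^^ k) f z) \<le> C * M * (1/2) ^ k"
proof -
  from assms obtain A B where hol: "\<Phi> holomorphic_on UNIV" and AB: "0 < A" "0 < B"
    and bd: "\<And>z. norm (\<Phi> z) \<le> A * exp (B * norm z)"
    unfolding exponential_type_def entire_functions_def by blast
  define \<rho> where "\<rho> = 2 * exp 1 * B"
  have \<rho>: "0 < \<rho>" using AB by (simp add: \<rho>_def)
  have coeff: "norm ((deriv ^^ k) \<Phi> 0) \<le> A * exp 1 * (exp 1 * B) ^ k" for k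
  proof -
    define r where "r = real (Suc k) / B"
    have r: "0 < r" using AB by (simp add: r_def)
    have "norm ((deriv ^^ k) \<Phi> 0) \<le> fact k * (A * exp (B * r)) / r ^ k"
    proof (rule Cauchy_inequality)
      show "\<Phi> holomorphic_on ball 0 r" using hol holomorphic_on_subset by blast
      show "continuous_on (cball 0 r) \<Phi>"
        using hol holomorphic_on_imp_continuous_on continuous_on_subset by blast
      show "norm (\<Phi> x) \<le> A * exp (B * r)" if "norm (0 - x) = r" for x
        using bd[of x] that by simp
    qed (use r in auto)
    also have "B * r = real (Suc k)" using AB by (simp add: r_def)
    also have "exp (real (Suc k)) = exp 1 * exp (1::real) ^ k"
      by (metis exp_of_nat_mult mult.right_neutral power_Suc)
    also have "fact k * (A * (exp 1 * exp 1 ^ k)) / r ^ k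
        = (fact k / real (Suc k) ^ k) * (A * exp 1 * (exp 1 * B) ^ k)"
      using AB by (simp add: r_def power_divide power_mult_distrib)
    also have "\<dots> \<le> 1 * (A * exp 1 * (exp 1 * B) ^ k)"
    proof (rule mult_right_mono)
      have "fact k \<le> (real k ^ k)" using fact_le_power[of k, where 'a = real] by simp
      also have "\<dots> \<le> real (Suc k) ^ k" by (rule power_mono) auto
      finally show "fact k / real (Suc k) ^ k \<le> 1" by (simp add: divide_le_eq_1)
    qed (use AB in auto)
    finally show ?thesis by simp
  qed
  show thesis
  proof (rule that[of "A * exp 1" \<rho>])
    fix f z M k
    assume f: "f \<in> entire_functions" and M: "\<And>w. w \<in> cball z \<rho> \<Longrightarrow> norm (f w) \<le> M"
    have fh: "f holomorphic_on UNIV" using f by (simp add: entire_functions_def)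
    have M0: "0 \<le> M"
      by (rule order_trans[OF norm_ge_zero[of "f z"] M]) (use \<rho> in simp)
    have "norm ((deriv ^^ k) f z) \<le> fact k * M / \<rho> ^ k"
    proof (rule Cauchy_inequality)
      show "f holomorphic_on ball z \<rho>" using fh holomorphic_on_subset by blast
      show "continuous_on (cball z \<rho>) f"
        using fh holomorphic_on_imp_continuous_on continuous_on_subset by blast
      show "norm (f x) \<le> M" if "norm (z - x) = \<rho>" for x
        using M[of x] that by (simp add: dist_norm)
    qed (use \<rho> in auto)
    then have "norm (fps_nth (fps_expansion \<Phi> 0) k * (deriv ^^ k) f z)
        \<le> (A * exp 1 * (exp 1 * B) ^ k / fact k) * (fact k * M / \<rho> ^ k)"
      unfolding fps_expansion_def fps_nth_Abs_fps norm_mult norm_divide norm_fact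
      by (intro mult_mono divide_right_mono coeff) (use AB in auto)
    also have "\<dots> = A * exp 1 * M * (1/2) ^ k"
      using AB by (simp add: \<rho>_def power_mult_distrib power_divide field_simps)
    finally show "norm (fps_nth (fps_expansion \<Phi> 0) k * (deriv ^^ k) f z)
        \<le> A * exp 1 * M * (1/2) ^ k" .
  qed (use AB \<rho> in auto)
qed

lemma entire_bounded_on_compact:
  assumes "f \<in> entire_functions" "compact K"
  obtains M where "\<And>w. w \<in> K \<Longrightarrow> norm (f w) \<le> M"
proof -
  have "continuous_on K f"
    using assms(1) holomorphic_on_imp_continuous_on continuous_on_subset
    unfolding entire_functions_def by blast
  then have "bounded (f ` K)"
    using assms(2) compact_continuous_image compact_imp_bounded by blast
  then show thesis using that unfolding bounded_iff by blast
qed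

lemma summable_geo_half: "summable (\<lambda>k. (c::real) * (1/2) ^ k)"
  by (intro summable_mult summable_geometric) simp

lemma diff_op_summable:
  assumes "exponential_type \<Phi>" "f \<in> entire_functions"
  shows "summable (\<lambda>k. fps_nth (fps_expansion \<Phi> 0) k * (deriv ^^ k) f z)"
proof -
  obtain C \<rho> where C: "0 < C" "0 < \<rho>"
    "\<And>f z M k. f \<in> entire_functions \<Longrightarrow> (\<And>w. w \<in> cball z \<rho> \<Longrightarrow> norm (f w) \<le> M) \<Longrightarrow>
       norm (fps_nth (fps_expansion \<Phi> 0) k * (deriv ^^ k) f z) \<le> C * M * (1/2) ^ k"
    using diff_op_term_bound[OF assms(1)] by blast
  obtain M where M: "\<And>w. w \<in> cball z \<rho> \<Longrightarrow> norm (f w) \<le> M"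
    using entire_bounded_on_compact[OF assms(2) compact_cball] by blast
  show ?thesis
    by (rule summable_comparison_test'[OF summable_geo_half]) (rule C(3)[OF assms(2) M])
qed

lemma diff_op_entire:
  assumes "exponential_type \<Phi>" "f \<in> entire_functions"
  shows "diff_op \<Phi> f \<in> entire_functions"
proof -
  obtain C \<rho> where C: "0 < C" "0 < \<rho>"
    "\<And>f z M k. f \<in> entire_functions \<Longrightarrow> (\<And>w. w \<in> cball z \<rho> \<Longrightarrow> norm (f w) \<le> M) \<Longrightarrow>
       norm (fps_nth (fps_expansion \<Phi> 0) k * (deriv ^^ k) f z) \<le> C * M * (1/2) ^ k"
    using diff_op_term_bound[OF assms(1)] by blast
  have fh: "f holomorphic_on UNIV" using assms(2) by (simp add: entire_functions_def)
  have "(\<lambda>z. \<Sum>k. fps_nth (fps_expansion \<Phi> 0) k * (deriv ^^ k) f z) holomorphic_on UNIV"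
  proof (rule holomorphic_uniform_sequence[where
        f = "\<lambda>n z. \<Sum>k<n. fps_nth (fps_expansion \<Phi> 0) k * (deriv ^^ k) f z"])
    show "(\<lambda>z. \<Sum>k<n. fps_nth (fps_expansion \<Phi> 0) k * (deriv ^^ k) f z) holomorphic_on UNIV" for n
      by (intro holomorphic_intros holomorphic_higher_deriv[OF fh]) auto
    fix x :: complex
    obtain M where M: "\<And>w. w \<in> cball x (1 + \<rho>) \<Longrightarrow> norm (f w) \<le> M"
      using entire_bounded_on_compact[OF assms(2) compact_cball] by blast
    have sub: "w \<in> cball x (1 + \<rho>)" if "z \<in> cball x 1" "w \<in> cball z \<rho>" for z w
      using that dist_triangle[of x w z] by simp
    have "uniform_limit (cball x 1)
        (\<lambda>n z. \<Sum>k<n. fps_nth (fps_expansion \<Phi> 0) k * (deriv ^^ k) f z)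
        (\<lambda>z. \<Sum>k. fps_nth (fps_expansion \<Phi> 0) k * (deriv ^^ k) f z) sequentially"
    proof (rule Weierstrass_m_test[OF _ summable_geo_half])
      fix k z assume z: "z \<in> cball x 1"
      show "norm (fps_nth (fps_expansion \<Phi> 0) k * (deriv ^^ k) f z) \<le> (C * M) * (1/2) ^ k"
        by (rule C(3)[OF assms(2)]) (rule M[OF sub[OF z]])
    qed
    then show "\<exists>d>0. cball x d \<subseteq> UNIV \<and> uniform_limit (cball x d)
        (\<lambda>n z. \<Sum>k<n. fps_nth (fps_expansion \<Phi> 0) k * (deriv ^^ k) f z)
        (\<lambda>z. \<Sum>k. fps_nth (fps_expansion \<Phi> 0) k * (deriv ^^ k) f z) sequentially"
      by (intro exI[of _ 1]) auto
  qed auto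
  then show ?thesis by (simp add: entire_functions_def diff_op_def[abs_def])
qed

lemma diff_op_add:
  assumes "exponential_type \<Phi>" "f \<in> entire_functions" "g \<in> entire_functions"
  shows "diff_op \<Phi> (\<lambda>z. f z + g z) = (\<lambda>z. diff_op \<Phi> f z + diff_op \<Phi> g z)"
proof
  fix z
  have "(deriv ^^ k) (\<lambda>z. f z + g z) z = (deriv ^^ k) f z + (deriv ^^ k) g z" for k
    using assms(2,3) by (intro higher_deriv_add[of _ UNIV]) (auto simp: entire_functions_def)
  then show "diff_op \<Phi> (\<lambda>z. f z + g z) z = diff_op \<Phi> f z + diff_op \<Phi> g z"
    unfolding diff_op_def
    using suminf_add[OF diff_op_summable[OF assms(1,2), of z] diff_op_summable[OF assms(1,3), of z]]
    by (simp add: algebra_simps)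
qed

lemma diff_op_cmult:
  assumes "exponential_type \<Phi>" "f \<in> entire_functions"
  shows "diff_op \<Phi> (\<lambda>z. c * f z) = (\<lambda>z. c * diff_op \<Phi> f z)"
proof
  fix z
  have "(deriv ^^ k) (\<lambda>z. c * f z) z = c * (deriv ^^ k) f z" for k
    using assms(2) by (intro higher_deriv_cmult[of _ UNIV]) (auto simp: entire_functions_def)
  then show "diff_op \<Phi> (\<lambda>z. c * f z) z = c * diff_op \<Phi> f z"
    unfolding diff_op_def
    using suminf_mult[OF diff_op_summable[OF assms, of z], of c]
    by (simp add: algebra_simps)
qed

lemma diff_op_continuous:
  assumes \<Phi>: "exponential_type \<Phi>"
  shows "continuous_map entire_topology entire_topology (diff_op \<Phi>)"
  unfolding continuous_map_def topspace_entire_topology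
proof (intro conjI allI impI)
  show "diff_op \<Phi> \<in> entire_functions \<rightarrow> entire_functions"
    using diff_op_entire[OF \<Phi>] by blast
  fix U assume U: "openin entire_topology U"
  obtain C \<rho> where C: "0 < C" "0 < \<rho>"
    "\<And>f z M k. f \<in> entire_functions \<Longrightarrow> (\<And>w. w \<in> cball z \<rho> \<Longrightarrow> norm (f w) \<le> M) \<Longrightarrow>
       norm (fps_nth (fps_expansion \<Phi> 0) k * (deriv ^^ k) f z) \<le> C * M * (1/2) ^ k"
    using diff_op_term_bound[OF \<Phi>] by blast
  show "openin entire_topology {f \<in> entire_functions. diff_op \<Phi> f \<in> U}"
    unfolding openin_entire_topology
  proof (intro conjI ballI)
    fix f assume "f \<in> {f \<in> entire_functions. diff_op \<Phi> f \<in> U}"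
    then have f: "f \<in> entire_functions" "diff_op \<Phi> f \<in> U" by auto
    obtain K e where K: "compact K" "0 < e"
      "{g \<in> entire_functions. \<forall>z\<in>K. dist (g z) (diff_op \<Phi> f z) < e} \<subseteq> U"
      using U f(2) unfolding openin_entire_topology by blast
    obtain r where r: "\<And>z. z \<in> K \<Longrightarrow> norm z \<le> r"
      using compact_imp_bounded[OF K(1)] unfolding bounded_iff by blast
    define d where "d = e / (4 * C)"
    have d: "0 < d" using K C by (simp add: d_def)
    have "diff_op \<Phi> g \<in> U"
      if g: "g \<in> entire_functions" and gf: "\<forall>z\<in>cball 0 (r + \<rho>). dist (g z) (f z) < d" for g
    proof -
      define h where "h = (\<lambda>z. g z + (-1) * f z)"
      have mf: "(\<lambda>z. (-1) * f z) \<in> entire_functions"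
        using f(1) unfolding entire_functions_def by (auto intro!: holomorphic_intros)
      have h: "h \<in> entire_functions"
        using f(1) g unfolding entire_functions_def h_def by (auto intro!: holomorphic_intros)
      have dh: "diff_op \<Phi> h z = diff_op \<Phi> g z - diff_op \<Phi> f z" for z
        unfolding h_def diff_op_add[OF \<Phi> g mf] diff_op_cmult[OF \<Phi> f(1)] by simp
      have "dist (diff_op \<Phi> g z) (diff_op \<Phi> f z) < e" if z: "z \<in> K" for z
      proof -
        have "norm (h w) \<le> d" if "w \<in> cball z \<rho>" for w
        proof -
          have "norm w \<le> r + \<rho>"
            using that r[OF z] norm_triangle_ineq[of z "w - z"] by (simp add: dist_norm norm_minus_commute)
          then show ?thesis using gf by (force simp: h_def dist_norm)
        qed
        then have b: "norm (fps_nth (fps_expansion \<Phi> 0) k * (deriv ^^ k) h z) \<le> (C * d) * (1/2) ^ k" for k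
          using C(3)[OF h] by simp
        have "norm (diff_op \<Phi> h z) \<le> (\<Sum>k. (C * d) * (1/2) ^ k)"
          unfolding diff_op_def by (rule norm_suminf_le[OF b summable_geo_half])
        also have "\<dots> = (C * d) * (\<Sum>k. (1/2) ^ k)"
          by (rule suminf_mult) (simp add: summable_geometric)
        also have "\<dots> = C * d * 2" by (subst suminf_geometric) auto
        also have "\<dots> < e" using C K by (simp add: d_def)
        finally show ?thesis by (simp add: dh dist_norm)
      qed
      then show ?thesis using K(3) diff_op_entire[OF \<Phi> g] by blast
    qed
    then show "\<exists>K e. compact K \<and> 0 < e \<and> {g \<in> entire_functions. \<forall>z\<in>K. dist (g z) (f z) < e}
        \<subseteq> {f \<in> entire_functions. diff_op \<Phi> f \<in> U}"
      by (intro exI[of _ "cball 0 (r + \<rho>)"] exI[of _ d]) (use d in auto)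
  qed auto
qed

end

theory Submission
  imports Defs
begin

text \<open>Each exponential \<open>e\<^sub>t(z) = exp (t z)\<close> is an eigenfunction of \<open>\<Phi>(D)\<close> with eigenvalue \<open>\<Phi> t\<close>. A
  polynomial \<open>P\<close> is a superposition of exponentials over any circle about the origin, its density
  being a Laurent polynomial \<open>g\<close>, the Borel transform of \<open>P\<close>. Dividing this
  density by \<open>\<Phi> n\<close> gives a right inverse \<open>S\<^sub>n P\<close> of \<open>\<Phi> n (D)\<close> at \<open>P\<close>, and
  \<open>\<Phi> n (D) (S\<^sub>j P)\<close> has density \<open>g \<Phi> n / \<Phi> j\<close>. As \<open>\<Phi> j\<close> has no zeros in the annulus,
  Cauchy's theorem lets the circle be chosen separately for each purpose: radius \<open>R3\<close> to sum the
  \<open>S\<^sub>j P\<close>, radius \<open>R1\<close> to estimate \<open>\<Phi> n (D) (S\<^sub>j P)\<close> for \<open>j < n\<close>, and radius \<open>R2\<close> for \<open>j > n\<close>.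

  Enumerate a dense sequence of polynomials \<open>P l\<close>, each repeated infinitely often, and let
  \<open>f = (\<Sum>l. \<Sum>j\<in>A l. S\<^sub>j (P l))\<close> with sets \<open>A l\<close> of positive lower density. For \<open>n \<in> A l\<close> the
  term \<open>j = n\<close> of \<open>\<Phi> n (D) f\<close> is \<open>P l\<close>, and it must be shown that the others contribute little.

  Bounded row sums of \<open>\<alpha>\<close> do not make the contribution of remote \<open>j\<close> small uniformly in \<open>n\<close>.
  But the ratios \<open>\<Phi> n / \<Phi> j\<close> are multiplicative: each \<open>i\<close> strictly between \<open>j\<close> and \<open>n\<close> gives
  the bound \<open>\<alpha> n i * \<alpha> i j\<close> for \<open>|\<Phi> n / \<Phi> j|\<close>. Summing over \<open>i\<close>, and then over \<open>j\<close>, yields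
  \<open>(\<Sum>j<n. (n - j - 1) |\<Phi> n / \<Phi> j|) \<le> C\<^sup>2\<close>, and likewise above \<open>n\<close> with \<open>\<beta>\<close>
  (\<open>card_mult_norm_le_of_chains\<close>, \<open>sum_iterated_kernel_le\<close>). So the ratios have a bounded first
  moment in the gap \<open>|n - j|\<close>. Let \<open>c m\<close> bound the density of \<open>P m\<close>, and let \<open>r l\<close> be numbers
  that tend to infinity along the repetitions of each polynomial. If any two distinct points
  \<open>n \<in> A l\<close> and \<open>j \<in> A m\<close> are further apart than \<open>r l * c m\<close>, then on each compact set the
  total error is of order \<open>1 / r l\<close> (\<open>superposition_nearly_interpolates\<close>). Sets with this separation are
  provided by \<open>separated_sets_of_positive_lower_density\<close>.\<close>

section \<open>Separated sets of positive lower density\<close>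

lemma lower_density_mono:
  assumes "S \<subseteq> T"
  shows "lower_density S \<le> lower_density T"
  unfolding lower_density_def
proof (rule Liminf_mono, intro always_eventually allI)
  fix n :: nat
  have "card (S \<inter> {1..n}) \<le> card (T \<inter> {1..n})"
    using assms by (intro card_mono) auto
  then show "ereal (real (card (S \<inter> {1..n})) / real n) \<le> ereal (real (card (T \<inter> {1..n})) / real n)"
    by (simp add: divide_right_mono)
qed

lemma lower_density_pos:
  assumes "0 < M" and "\<And>n. n div M \<le> card (S \<inter> {1..n})"
  shows "0 < lower_density S"
proof -
  have "ereal (1 / (2 * real M)) \<le> lower_density S"
    unfolding lower_density_def
  proof (rule Liminf_bounded, rule eventually_sequentiallyI[of "2 * M"])
    fix n assume n: "2 * M \<le> n"
    have "n \<le> M * (n div M + 1)"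
      using assms(1) by (simp add: dividend_less_times_div less_imp_le)
    then have "real n \<le> real M * (real (n div M) + 1)"
      by (metis of_nat_1 of_nat_add of_nat_le_iff of_nat_mult)
    then have "real n / real M - 1 \<le> real (n div M)"
      using assms(1) by (simp add: field_simps)
    moreover have "real n / (2 * real M) \<le> real n / real M - 1"
      using n assms(1) by (simp add: field_simps)
    ultimately have "real n / (2 * real M) \<le> real (card (S \<inter> {1..n}))"
      using assms(2)[of n] by linarith
    then show "ereal (1 / (2 * real M)) \<le> ereal (real (card (S \<inter> {1..n})) / real n)"
      using n assms(1) by (simp add: field_simps)
  qed
  moreover have "0 < ereal (1 / (2 * real M))" using assms(1) by simp
  ultimately show ?thesis by (rule less_le_trans[rotated])
qed

text \<open>The sum is the 2-adic valuation \<open>V k\<close> of \<open>k!\<close>. Halving the even numbers up to \<open>2 m\<close> lowers each of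
  their valuations by one, so that \<open>V (2 m) = m + V m\<close>.\<close>

lemma sum_multiplicity_two_le: "(\<Sum>i=1..k. multiplicity 2 i) \<le> (k::nat)"
proof (induction k rule: less_induct)
  case (less k)
  have double: "(\<Sum>i=1..2*m. multiplicity 2 i) = m + (\<Sum>i=1..m. multiplicity 2 i)" for m :: nat
  proof (induction m)
    case (Suc m)
    have "multiplicity 2 (Suc (2 * m)) = 0" by (intro not_dvd_imp_multiplicity_0) presburger
    moreover have "multiplicity 2 (2 * Suc m) = Suc (multiplicity 2 (Suc m))"
      by (rule multiplicity_times_same) auto
    ultimately show ?case using Suc by simp
  qed simp
  show ?case
  proof (cases "k = 0")
    case False
    then have IH: "(\<Sum>i=1..k div 2. multiplicity 2 i) \<le> k div 2" by (intro less) simp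
    show ?thesis
    proof (cases "even k")
      case True
      then obtain m where "k = 2 * m" by blast
      then show ?thesis using double[of m] IH by simp
    next
      case False
      then obtain m where m: "k = Suc (2 * m)" by (metis oddE Suc_eq_plus1)
      have "multiplicity 2 k = 0" using False by (rule not_dvd_imp_multiplicity_0)
      then show ?thesis using double[of m] IH m by simp
    qed
  qed simp
qed

text \<open>A point \<open>q k\<close> is placed for each \<open>k \<ge> 1\<close>, leaving a free interval of length about \<open>v k\<close>
  on either side of it, where \<open>v\<close> is the 2-adic valuation. Because the average of \<open>v\<close> is bounded,
  \<open>q k\<close> grows only linearly, and the level sets of \<open>v\<close>, which contain arithmetic progressions,
  keep a positive lower density when they are moved by \<open>q\<close>.\<close>

lemma separated_sets_of_positive_lower_density:
  obtains B :: "nat \<Rightarrow> nat set" where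
    "\<And>i. 0 < lower_density (B i)"
    "\<And>i n. n \<in> B i \<Longrightarrow> i < n"
    "\<And>i j m n. m \<in> B i \<Longrightarrow> n \<in> B j \<Longrightarrow> i \<noteq> j \<or> m \<noteq> n \<Longrightarrow> int (i + j + 2) \<le> \<bar>int m - int n\<bar>"
proof -
  define v :: "nat \<Rightarrow> nat" where "v = multiplicity 2"
  define p where "p = (\<lambda>k. \<Sum>i=1..k. v i + 1)"
  \<comment> \<open>\<open>p k\<close> alone leaves room on the left of a point; the summand \<open>p (k - 1)\<close> adds room on its right.\<close>
  define q where "q = (\<lambda>k. p k + p (k - 1))"
  have p_Suc: "p (Suc k) = p k + v (Suc k) + 1" for k by (simp add: p_def)
  have p_mono: "p k \<le> p l" if "k \<le> l" for k l
    using that by (rule lift_Suc_mono_le[rotated]) (simp add: p_Suc)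
  have p_ge: "p (k - 1) + v k + 1 = p k" if "1 \<le> k" for k
    using that p_Suc[of "k - 1"] by simp
  have p_le: "p k \<le> 2 * k" for k
    using sum_multiplicity_two_le[of k] unfolding p_def v_def by (subst sum.distrib) simp
  have q_le: "q k \<le> 4 * k" for k
    using p_le[of k] p_mono[of "k - 1" k] by (simp add: q_def)
  have gap: "q k + (v k + v l + 2) \<le> q l" if "1 \<le> k" "k < l" for k l
    using that p_ge[of k] p_ge[of l] p_mono[of k "l - 1"]
    unfolding q_def by linarith
  have inj: "inj_on q {1..}"
  proof (rule linorder_inj_onI)
    fix k l :: nat assume "k < l" "k \<in> {1..}"
    then show "q k \<noteq> q l" using gap[of k l] by simp
  qed auto
  define B where "B = (\<lambda>i. q ` {k. 1 \<le> k \<and> v k = i})"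
  show thesis
  proof
    fix i
    show "0 < lower_density (B i)"
    proof (rule lower_density_pos[of "2 ^ (i + 3)"])
      fix n :: nat
      define s where "s = n div 2 ^ (i + 3)"
      define k where "k = (\<lambda>r::nat. 2 ^ i * (2 * r + 1))"
      have vk: "v (k r) = i" for r
      proof -
        have "multiplicity 2 (2 * r + 1) = 0" by (intro not_dvd_imp_multiplicity_0) presburger
        then show ?thesis unfolding v_def k_def
          by (subst prime_elem_multiplicity_mult_distrib) (auto simp: multiplicity_same_power)
      qed
      have "k r \<ge> 1" for r
        unfolding k_def using one_le_power[of "2::nat" i] by (simp add: trans_le_add1)
      have in_B: "q (k r) \<in> B i \<inter> {1..n}" if "r < s" for r
      proof -
        have "q (k r) \<le> 4 * k r" by (rule q_le)
        also have "\<dots> \<le> 4 * (2 ^ i * (2 * s))" unfolding k_def using that by (intro mult_left_mono) auto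
        also have "\<dots> = s * 2 ^ (i + 3)" by (simp add: power_add)
        also have "\<dots> \<le> n" unfolding s_def by (rule div_times_less_eq_dividend)
        finally have "q (k r) \<le> n" .
        moreover have "1 \<le> q (k r)" using p_ge[of "k r"] \<open>k r \<ge> 1\<close> by (simp add: q_def)
        ultimately show ?thesis using vk \<open>k r \<ge> 1\<close> by (auto simp: B_def)
      qed
      have "inj_on (\<lambda>r. q (k r)) {..<s}"
      proof (rule inj_onI)
        fix x y assume "q (k x) = q (k y)"
        then have "k x = k y" using inj \<open>\<And>r. k r \<ge> 1\<close> by (auto dest: inj_onD)
        then show "x = y" by (simp add: k_def)
      qed
      then have "s = card ((\<lambda>r. q (k r)) ` {..<s})" by (simp add: card_image)
      also have "\<dots> \<le> card (B i \<inter> {1..n})" using in_B by (intro card_mono) auto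
      finally show "n div 2 ^ (i + 3) \<le> card (B i \<inter> {1..n})" by (simp add: s_def)
    qed simp
  next
    fix i n assume "n \<in> B i"
    then show "i < n" using p_ge by (fastforce simp: B_def q_def)
  next
    fix i j m n assume "m \<in> B i" "n \<in> B j" and ne: "i \<noteq> j \<or> m \<noteq> n"
    then obtain k l where kl: "1 \<le> k" "v k = i" "m = q k" "1 \<le> l" "v l = j" "n = q l"
      by (auto simp: B_def)
    with ne have "k < l \<or> l < k" by (metis nat_neq_iff)
    then show "int (i + j + 2) \<le> \<bar>int m - int n\<bar>"
      using gap[of k l] gap[of l k] kl by auto
  qed
qed

section \<open>Superpositions of exponentials over a circle\<close>

text \<open>For \<open>h\<close> holomorphic outside a smaller disc and vanishing at infinity this is the Polya representation,
  that is, the inverse Borel transform of \<open>h\<close>; here \<open>h\<close> is an arbitrary density on the circle.\<close>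

definition exp_superposition :: "real \<Rightarrow> (complex \<Rightarrow> complex) \<Rightarrow> complex \<Rightarrow> complex" where
  "exp_superposition R h z =
     contour_integral (circlepath 0 R) (\<lambda>t. exp (t * z) * h t) / (2 * of_real pi * \<i>)"

lemma exp_superposition_integrable:
  assumes "0 < R" "continuous_on (sphere 0 R) h"
  shows "(\<lambda>t. exp (t * z) * h t) contour_integrable_on circlepath 0 R"
  using assms by (intro contour_integrable_continuous_circlepath continuous_intros) auto

lemma exp_superposition_cong:
  assumes "0 < R" "\<And>t. norm t = R \<Longrightarrow> g t = h t"
  shows "exp_superposition R g = exp_superposition R h"
  unfolding exp_superposition_def using assms
  by (intro ext arg_cong2[where f = "(/)"] contour_integral_cong) auto

lemma exp_superposition_bound:
  assumes "0 < R" "continuous_on (sphere 0 R) h" "\<And>t. norm t = R \<Longrightarrow> norm (h t) \<le> B"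
  shows "norm (exp_superposition R h z) \<le> R * exp (R * norm z) * B"
proof -
  have "norm (of_real R :: complex) = R" using assms(1) by simp
  then have "0 \<le> B" using assms(3)[of "of_real R"] norm_ge_zero order_trans by blast
  have "norm (contour_integral (circlepath 0 R) (\<lambda>t. exp (t * z) * h t))
      \<le> (exp (R * norm z) * B) * (2 * pi * R)"
  proof (rule has_contour_integral_bound_circlepath)
    show "norm (exp (x * z) * h x) \<le> exp (R * norm z) * B" if "norm (x - 0) = R" for x
    proof -
      have "norm (exp (x * z)) \<le> exp (norm (x * z))" by (rule norm_exp)
      then show ?thesis using assms(3)[of x] that unfolding norm_mult
        by (intro mult_mono) (auto simp: norm_mult)
    qed
  qed (use assms \<open>0 \<le> B\<close> has_contour_integral_integral[OF exp_superposition_integrable] in auto)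
  then show ?thesis
    unfolding exp_superposition_def norm_divide by (simp add: norm_mult field_simps)
qed

lemma exp_superposition_sum:
  assumes "0 < R" "finite I" "\<And>i. i \<in> I \<Longrightarrow> continuous_on (sphere 0 R) (h i)"
  shows "exp_superposition R (\<lambda>t. \<Sum>i\<in>I. h i t) z = (\<Sum>i\<in>I. exp_superposition R (h i) z)"
  using contour_integral_sum[OF assms(2), of "\<lambda>i t. exp (t * z) * h i t"]
    exp_superposition_integrable[OF assms(1) assms(3)]
  by (simp add: exp_superposition_def sum_distrib_left sum_divide_distrib)

lemma exp_superposition_cmult:
  assumes "0 < R" "continuous_on (sphere 0 R) h"
  shows "exp_superposition R (\<lambda>t. c * h t) z = c * exp_superposition R h z"
  using contour_integral_lmul[OF exp_superposition_integrable[OF assms, of z], of c]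
  by (simp add: exp_superposition_def mult.left_commute)

lemma exp_superposition_uniform_limit:
  assumes "0 < R" "\<And>n. continuous_on (sphere 0 R) (g n)"
    and lim: "uniform_limit (sphere 0 R) g h sequentially"
  shows "(\<lambda>n. exp_superposition R (g n) z) \<longlonglongrightarrow> exp_superposition R h z"
proof -
  have "bounded ((\<lambda>t. exp (t * z)) ` sphere 0 R)"
    by (intro compact_imp_bounded compact_continuous_image continuous_intros) auto
  moreover have "continuous_on (sphere 0 R) h"
    using assms(2) by (intro uniform_limit_theorem[OF _ lim]) auto
  then have "bounded (h ` sphere 0 R)"
    by (intro compact_imp_bounded compact_continuous_image) auto
  ultimately have "uniform_limit (sphere 0 R) (\<lambda>n t. exp (t * z) * g n t) (\<lambda>t. exp (t * z) * h t) sequentially"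
    by (intro uniform_lim_mult uniform_limit_const lim)
  then have "(\<lambda>n. contour_integral (circlepath 0 R) (\<lambda>t. exp (t * z) * g n t))
      \<longlonglongrightarrow> contour_integral (circlepath 0 R) (\<lambda>t. exp (t * z) * h t)"
    using assms(1) exp_superposition_integrable[OF assms(1,2)]
    by (intro contour_integral_uniform_limit_circlepath) auto
  then show ?thesis unfolding exp_superposition_def by (intro tendsto_divide tendsto_const) auto
qed

lemma exp_superposition_has_field_derivative:
  assumes R: "0 < R" and h: "continuous_on (sphere 0 R) h"
  shows "(exp_superposition R h has_field_derivative exp_superposition R (\<lambda>t. t * h t) z) (at z)"
proof -
  define c where "c = circlepath 0 R"
  define c' where "c' = (\<lambda>s. vector_derivative c (at s))"
  have c': "c' = (\<lambda>s. 2 * pi * \<i> * R * exp (2 * of_real pi * \<i> * s))"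
    by (simp add: c'_def c_def vector_derivative_circlepath)
  have hc: "continuous_on {0..1} (\<lambda>s. h (c s))"
    using R unfolding c_def
    by (intro continuous_on_compose2[OF h]) (auto simp: circlepath norm_mult intro!: continuous_intros)
  have "((\<lambda>w. integral (cbox 0 1) (\<lambda>s. exp (c s * w) * h (c s) * c' s)) has_field_derivative
      integral (cbox 0 1) (\<lambda>s. exp (c s * z) * (c s * h (c s)) * c' s)) (at z within UNIV)"
  proof (rule leibniz_rule_field_derivative)
    show "((\<lambda>w. exp (c s * w) * h (c s) * c' s) has_field_derivative
        exp (c s * w) * (c s * h (c s)) * c' s) (at w within UNIV)" for w s
      by (auto intro!: derivative_eq_intros)
    show "(\<lambda>s. exp (c s * w) * h (c s) * c' s) integrable_on cbox 0 1" for w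
      using hc unfolding c' by (intro integrable_continuous continuous_intros) (auto simp: c_def circlepath intro!: continuous_intros)
    have "continuous_on (UNIV \<times> {0..1}) (\<lambda>(w::complex, s). h (c s))"
      unfolding split_beta by (rule continuous_on_compose2[OF hc continuous_on_snd]) auto
    then have "continuous_on (UNIV \<times> {0..1}) (\<lambda>p::complex \<times> real. h (c (snd p)))"
      by (simp add: split_beta)
    then show "continuous_on (UNIV \<times> cbox 0 1) (\<lambda>(w, s). exp (c s * w) * (c s * h (c s)) * c' s)"
      unfolding c' split_beta by (auto simp: c_def circlepath intro!: continuous_intros)
  qed auto
  then have "((\<lambda>w. contour_integral c (\<lambda>t. exp (t * w) * h t)) has_field_derivative
      contour_integral c (\<lambda>t. exp (t * z) * (t * h t))) (at z)"
    by (simp add: contour_integral_integral c'_def)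
  from DERIV_cdivide[OF this, of "2 * of_real pi * \<i>"] show ?thesis
    by (simp add: exp_superposition_def[abs_def] c_def)
qed

lemma exp_superposition_entire:
  assumes "0 < R" "continuous_on (sphere 0 R) h"
  shows "exp_superposition R h \<in> entire_functions"
  using exp_superposition_has_field_derivative[OF assms]
  by (auto simp: entire_functions_def holomorphic_on_def field_differentiable_def intro: DERIV_subset)

lemma higher_deriv_exp_superposition:
  assumes "0 < R" "continuous_on (sphere 0 R) h"
  shows "(deriv ^^ k) (exp_superposition R h) = exp_superposition R (\<lambda>t. t ^ k * h t)"
proof (induction k)
  case (Suc k)
  have "deriv (exp_superposition R (\<lambda>t. t ^ k * h t)) = exp_superposition R (\<lambda>t. t * (t ^ k * h t))"
    using assms
    by (intro ext DERIV_imp_deriv exp_superposition_has_field_derivative continuous_intros)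
  then show ?case using Suc by (simp add: mult.assoc)
qed simp

lemma entire_taylor_uniform_limit:
  assumes "\<Phi> \<in> entire_functions"
  shows "uniform_limit (cball 0 r) (\<lambda>n t. \<Sum>k<n. fps_nth (fps_expansion \<Phi> 0) k * t ^ k) \<Phi> sequentially"
proof -
  define s where "s = \<bar>r\<bar> + 1"
  define a where "a = fps_nth (fps_expansion \<Phi> 0)"
  have sums: "(\<lambda>k. a k * t ^ k) sums \<Phi> t" for t
  proof -
    have "(\<lambda>n. (deriv ^^ n) \<Phi> 0 / fact n * (t - 0) ^ n) sums \<Phi> t"
      using assms by (intro holomorphic_power_series[of _ _ "norm t + 1"])
        (auto simp: entire_functions_def intro: holomorphic_on_subset)
    then show ?thesis by (simp add: a_def fps_expansion_def)
  qed
  have "uniform_limit (cball 0 \<bar>r\<bar>) (\<lambda>n t. \<Sum>k<n. a k * (t - 0) ^ k) (\<lambda>t. \<Sum>k. a k * (t - 0) ^ k) sequentially"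
  proof (rule powser_uniform_limit)
    have "summable (\<lambda>k. a k * of_real s ^ k)" using sums sums_summable by blast
    then have "ereal (norm (of_real s :: complex)) \<le> conv_radius a" by (rule conv_radius_geI)
    then show "ereal \<bar>r\<bar> < conv_radius a"
      by (rule less_le_trans[rotated]) (simp add: s_def)
  qed
  moreover have "(\<lambda>t. \<Sum>k. a k * (t - 0) ^ k) = \<Phi>"
    using sums by (auto simp: sums_iff)
  ultimately have "uniform_limit (cball 0 \<bar>r\<bar>) (\<lambda>n t. \<Sum>k<n. a k * t ^ k) \<Phi> sequentially"
    by simp
  then show ?thesis unfolding a_def by (rule uniform_limit_on_subset) auto
qed

text \<open>Differentiating under the integral multiplies the density by \<open>t\<close>; the Taylor series of \<open>\<Phi>\<close>
  converges uniformly on the circle and can be summed inside the integral.\<close>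

lemma diff_op_exp_superposition:
  assumes \<Phi>: "exponential_type \<Phi>" and R: "0 < R" and h: "continuous_on (sphere 0 R) h"
  shows "diff_op \<Phi> (exp_superposition R h) = exp_superposition R (\<lambda>t. \<Phi> t * h t)"
proof
  fix z
  define a where "a = fps_nth (fps_expansion \<Phi> 0)"
  have ent: "\<Phi> \<in> entire_functions" using \<Phi> by (simp add: exponential_type_def)
  have "uniform_limit (sphere 0 R) (\<lambda>n t. \<Sum>k<n. a k * t ^ k) \<Phi> sequentially"
    using entire_taylor_uniform_limit[OF ent, of R] unfolding a_def
    by (rule uniform_limit_on_subset) auto
  moreover have "bounded (h ` sphere 0 R)" "bounded (\<Phi> ` sphere 0 R)"
    using h ent unfolding entire_functions_def
    by (auto intro!: compact_imp_bounded compact_continuous_image holomorphic_on_imp_continuous_on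
        intro: holomorphic_on_subset)
  ultimately have "uniform_limit (sphere 0 R) (\<lambda>n t. (\<Sum>k<n. a k * t ^ k) * h t) (\<lambda>t. \<Phi> t * h t) sequentially"
    by (intro uniform_lim_mult uniform_limit_const)
  then have "(\<lambda>n. exp_superposition R (\<lambda>t. (\<Sum>k<n. a k * t ^ k) * h t) z)
      \<longlonglongrightarrow> exp_superposition R (\<lambda>t. \<Phi> t * h t) z"
    by (intro exp_superposition_uniform_limit R continuous_intros h)
  moreover have "exp_superposition R (\<lambda>t. (\<Sum>k<n. a k * t ^ k) * h t) z
      = (\<Sum>k<n. a k * (deriv ^^ k) (exp_superposition R h) z)" for n
  proof -
    have "exp_superposition R (\<lambda>t. (\<Sum>k<n. a k * t ^ k) * h t) z
        = exp_superposition R (\<lambda>t. \<Sum>k<n. a k * (t ^ k * h t)) z"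
      by (simp add: sum_distrib_right mult.assoc)
    also have "\<dots> = (\<Sum>k<n. exp_superposition R (\<lambda>t. a k * (t ^ k * h t)) z)"
      by (intro exp_superposition_sum R continuous_intros h) auto
    also have "\<dots> = (\<Sum>k<n. a k * exp_superposition R (\<lambda>t. t ^ k * h t) z)"
      by (intro sum.cong refl exp_superposition_cmult R continuous_intros h)
    finally show ?thesis by (simp add: higher_deriv_exp_superposition[OF R h])
  qed
  ultimately have "(\<lambda>k. a k * (deriv ^^ k) (exp_superposition R h) z)
      sums exp_superposition R (\<lambda>t. \<Phi> t * h t) z"
    by (simp add: sums_def)
  then show "diff_op \<Phi> (exp_superposition R h) z = exp_superposition R (\<lambda>t. \<Phi> t * h t) z"
    by (simp add: diff_op_def a_def sums_iff)
qed

text \<open>The radial homotopy between the two circles stays inside the closed annulus that they bound.\<close>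

lemma exp_superposition_change_radius:
  assumes "0 < R" "0 < R'" "open S" "h holomorphic_on S"
    and sub: "{t. min R R' \<le> norm t \<and> norm t \<le> max R R'} \<subseteq> S"
  shows "exp_superposition R h = exp_superposition R' h"
proof
  fix z
  have "homotopic_loops S (circlepath 0 R) (circlepath 0 R')"
  proof (rule homotopic_loops_linear)
    fix s :: real
    define e :: complex where "e = exp (2 * of_real pi * \<i> * of_real s)"
    show "closed_segment (circlepath 0 R s) (circlepath 0 R' s) \<subseteq> S"
    proof (rule subset_trans[OF _ sub], rule subsetI)
      fix t assume "t \<in> closed_segment (circlepath 0 R s) (circlepath 0 R' s)"
      then obtain u where u: "0 \<le> u" "u \<le> 1"
        and t: "t = (1 - u) *\<^sub>R (of_real R * e) + u *\<^sub>R (of_real R' * e)"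
        by (auto simp: in_segment circlepath e_def)
      define \<rho> where "\<rho> = (1 - u) * R + u * R'"
      have "t = of_real \<rho> * e" unfolding t \<rho>_def by (simp add: scaleR_conv_of_real algebra_simps)
      moreover have "norm e = 1" by (simp add: e_def)
      ultimately have "norm t = \<bar>\<rho>\<bar>" by (simp add: norm_mult)
      moreover have "\<rho> \<in> closed_segment R R'" using u unfolding in_segment \<rho>_def by auto
      then have "min R R' \<le> \<rho>" "\<rho> \<le> max R R'"
        by (auto simp: closed_segment_eq_real_ivl split: if_splits)
      ultimately show "t \<in> {t. min R R' \<le> norm t \<and> norm t \<le> max R R'}" using assms(1,2) by auto
    qed
  qed auto
  then have "contour_integral (circlepath 0 R) (\<lambda>t. exp (t * z) * h t)
      = contour_integral (circlepath 0 R') (\<lambda>t. exp (t * z) * h t)"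
  proof (rule Cauchy_theorem_homotopic_loops)
    show "(\<lambda>t. exp (t * z) * h t) holomorphic_on S" by (intro holomorphic_intros assms(4))
  qed (use assms(3) in auto)
  then show "exp_superposition R h z = exp_superposition R' h z"
    by (simp add: exp_superposition_def)
qed

section \<open>Polynomials as superpositions of exponentials\<close>

text \<open>The Borel transform of \<open>P\<close>: the monomial \<open>z\<^sup>k\<close> corresponds to \<open>k! / t\<^sup>k\<^sup>+\<^sup>1\<close>.\<close>

definition borel_symbol :: "complex poly \<Rightarrow> complex \<Rightarrow> complex" where
  "borel_symbol P t = (\<Sum>k\<le>degree P. coeff P k * (fact k / t ^ Suc k))"

lemma borel_symbol_holomorphic: "borel_symbol P holomorphic_on - {0}"
  unfolding borel_symbol_def[abs_def] by (intro holomorphic_intros) auto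

lemma borel_symbol_continuous:
  assumes "0 < R"
  shows "continuous_on (sphere 0 R) (borel_symbol P)"
  using assms by (intro holomorphic_on_imp_continuous_on holomorphic_on_subset[OF borel_symbol_holomorphic]) auto

text \<open>By Cauchy's formula the monomial \<open>k! / t\<^sup>k\<^sup>+\<^sup>1\<close> extracts the \<open>k\<close>-th derivative of
  \<open>t \<mapsto> exp (t z)\<close> at the origin.\<close>

lemma exp_superposition_borel_symbol:
  assumes "0 < R"
  shows "exp_superposition R (borel_symbol P) = poly P"
proof
  fix z :: complex
  have deriv: "(deriv ^^ k) (\<lambda>t. exp (t * z)) = (\<lambda>t. z ^ k * exp (t * z))" for k
  proof (induction k)
    case (Suc k)
    then show ?case
      by (auto intro!: ext DERIV_imp_deriv derivative_eq_intros)
  qed simp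
  have monomial: "exp_superposition R (\<lambda>t. fact k / t ^ Suc k) z = z ^ k" for k
  proof -
    have "contour_integral (circlepath 0 R) (\<lambda>t. exp (t * z) / (t - 0) ^ Suc k)
        = 2 * pi * \<i> * (deriv ^^ k) (\<lambda>t. exp (t * z)) 0 / fact k"
      using assms by (intro Cauchy_contour_integral_circlepath continuous_intros holomorphic_intros) auto
    moreover have "exp_superposition R (\<lambda>t. fact k * (1 / t ^ Suc k)) z
        = fact k * exp_superposition R (\<lambda>t. 1 / t ^ Suc k) z"
      using assms by (intro exp_superposition_cmult continuous_intros) auto
    ultimately show ?thesis by (simp add: exp_superposition_def deriv)
  qed
  have "exp_superposition R (borel_symbol P) z
      = (\<Sum>k\<le>degree P. exp_superposition R (\<lambda>t. coeff P k * (fact k / t ^ Suc k)) z)"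
    unfolding borel_symbol_def[abs_def] using assms
    by (intro exp_superposition_sum continuous_intros) auto
  also have "\<dots> = (\<Sum>k\<le>degree P. coeff P k * exp_superposition R (\<lambda>t. fact k / t ^ Suc k) z)"
    using assms by (intro sum.cong refl exp_superposition_cmult continuous_intros) auto
  finally show "exp_superposition R (borel_symbol P) z = poly P z"
    by (simp only: monomial poly_altdef)
qed

text \<open>Taylor polynomials approximate uniformly on compact sets, and their coefficients can be moved
  into a countable dense set of complex numbers.\<close>

lemma countable_dense_polynomials:
  obtains Q :: "complex poly set" where "countable Q" "Q \<noteq> {}"
    "\<And>f K e. f \<in> entire_functions \<Longrightarrow> compact K \<Longrightarrow> 0 < e \<Longrightarrow>
       \<exists>P\<in>Q. \<forall>z\<in>K. dist (poly P z) (f z) < e"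
proof -
  obtain D :: "complex set" where D: "countable D" "\<And>X. open X \<Longrightarrow> X \<noteq> {} \<Longrightarrow> \<exists>d\<in>D. d \<in> X"
    using countable_dense_setE by blast
  define Q where "Q = (\<lambda>xs. \<Sum>k<length xs. monom (xs ! k) k) ` lists D"
  show thesis
  proof
    show "countable Q" "Q \<noteq> {}" using D(1) by (auto simp: Q_def)
  next
    fix f :: "complex \<Rightarrow> complex" and K :: "complex set" and e :: real
    assume f: "f \<in> entire_functions" and K: "compact K" and e: "0 < e"
    obtain r where "\<forall>z\<in>K. norm z \<le> r" using compact_imp_bounded[OF K] bounded_iff by blast
    then have r: "0 \<le> \<bar>r\<bar>" "K \<subseteq> cball 0 \<bar>r\<bar>" by force+
    define a where "a = fps_nth (fps_expansion f 0)"
    have "\<forall>\<^sub>F n in sequentially. \<forall>z\<in>cball 0 \<bar>r\<bar>. dist (\<Sum>k<n. a k * z ^ k) (f z) < e / 2"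
      using uniform_limitD[OF entire_taylor_uniform_limit[OF f, of "\<bar>r\<bar>"], of "e / 2"] e by (simp add: a_def)
    then obtain n where n: "\<And>z. z \<in> cball 0 \<bar>r\<bar> \<Longrightarrow> dist (\<Sum>k<n. a k * z ^ k) (f z) < e / 2"
      unfolding eventually_sequentially by blast
    \<comment> \<open>On the disc of radius \<open>|r|\<close> each of the \<open>n\<close> coefficients is multiplied by at most
      \<open>(|r| + 1)\<^sup>n\<close>; the extra \<open>1\<close> in \<open>n + 1\<close> only avoids a division by zero.\<close>
    define \<delta> where "\<delta> = e / (2 * (real n + 1) * (\<bar>r\<bar> + 1) ^ n)"
    have \<delta>: "0 < \<delta>" using e by (simp add: \<delta>_def)
    have "\<exists>d\<in>D. d \<in> ball (a k) \<delta>" for k using D(2)[of "ball (a k) \<delta>"] \<delta> by simp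
    then obtain d where d: "\<And>k. d k \<in> D" "\<And>k. dist (a k) (d k) < \<delta>" by (metis mem_ball)
    define P where "P = (\<Sum>k<n. monom (d k) k)"
    have "P \<in> Q" using d(1) by (auto simp: P_def Q_def intro!: image_eqI[of _ _ "map d [0..<n]"])
    have poly_P: "poly P z = (\<Sum>k<n. d k * z ^ k)" for z
      by (simp add: P_def poly_sum poly_monom)
    have "dist (poly P z) (f z) < e" if "z \<in> K" for z
    proof -
      have z: "norm z \<le> \<bar>r\<bar>" using that r by auto
      have "norm ((d k - a k) * z ^ k) \<le> \<delta> * (\<bar>r\<bar> + 1) ^ n" if "k < n" for k
      proof -
        have "norm z ^ k \<le> (\<bar>r\<bar> + 1) ^ k" using z by (intro power_mono) auto
        also have "\<dots> \<le> (\<bar>r\<bar> + 1) ^ n" using that by (intro power_increasing) auto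
        finally show ?thesis using d(2)[of k] \<delta> unfolding norm_mult norm_power
          by (intro mult_mono) (auto simp: dist_norm norm_minus_commute)
      qed
      then have "norm (\<Sum>k<n. (d k - a k) * z ^ k) \<le> (\<Sum>k<n. \<delta> * (\<bar>r\<bar> + 1) ^ n)"
        by (intro sum_norm_le) auto
      also have "\<dots> = real n * (\<delta> * (\<bar>r\<bar> + 1) ^ n)" by simp
      also have "\<delta> * (\<bar>r\<bar> + 1) ^ n = e / (2 * (real n + 1))"
        unfolding \<delta>_def by (simp add: divide_simps)
      also have "real n * (e / (2 * (real n + 1))) = real n / (2 * (real n + 1)) * e" by simp
      also have "\<dots> \<le> e / 2" using e by (simp add: field_simps)
      finally have "dist (poly P z) (\<Sum>k<n. a k * z ^ k) \<le> e / 2"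
        by (simp add: poly_P dist_norm left_diff_distrib sum_subtractf)
      moreover have "dist (\<Sum>k<n. a k * z ^ k) (f z) < e / 2" using n z by simp
      ultimately show ?thesis using dist_triangle_le[of _ "\<Sum>k<n. a k * z ^ k"] 
        by (smt (verit) dist_triangle field_sum_of_halves)
    qed
    then show "\<exists>P\<in>Q. \<forall>z\<in>K. dist (poly P z) (f z) < e" using \<open>P \<in> Q\<close> by blast
  qed
qed

section \<open>First moments of ratio kernels\<close>

text \<open>Averages the bounds for \<open>x\<close> in terms of \<open>z\<close> obtained by passing through each of the
  intermediate \<open>y i\<close>. With \<open>x\<close>, \<open>y i\<close>, \<open>z\<close> the values of \<open>\<Phi> n\<close>, \<open>\<Phi> i\<close>, \<open>\<Phi> j\<close> and \<open>I\<close> the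
  indices strictly between \<open>j\<close> and \<open>n\<close>, the left-hand side carries the gap \<open>|n - j| - 1\<close> as a factor,
  which is how bounded sums become bounded first moments.\<close>

lemma card_mult_norm_le_of_chains:
  fixes x z :: "'a::real_normed_vector" and y :: "'b \<Rightarrow> 'a"
  assumes "\<And>i. i \<in> I \<Longrightarrow> 0 \<le> p i"
    and "\<And>i. i \<in> I \<Longrightarrow> norm x \<le> p i * norm (y i)"
    and "\<And>i. i \<in> I \<Longrightarrow> norm (y i) \<le> q i * norm z"
  shows "real (card I) * norm x \<le> (\<Sum>i\<in>I. p i * q i) * norm z"
proof -
  have "(\<Sum>i\<in>I. norm x) \<le> (\<Sum>i\<in>I. p i * q i * norm z)"
  proof (rule sum_mono)
    fix i assume i: "i \<in> I"
    have "norm x \<le> p i * norm (y i)" using assms(2)[OF i] .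
    also have "\<dots> \<le> p i * (q i * norm z)"
      using assms(1,3)[OF i] by (intro mult_left_mono)
    finally show "norm x \<le> p i * q i * norm z" by (simp add: mult.assoc)
  qed
  then show ?thesis by (simp add: sum_distrib_right)
qed

text \<open>The right-hand sides of the chain bounds form the square of the kernel \<open>\<alpha>\<close>, whose row sums are
  bounded by the square of the bound for \<open>\<alpha>\<close>. The next lemma is the same for columns.\<close>

lemma sum_iterated_kernel_le:
  fixes \<alpha> :: "nat \<Rightarrow> nat \<Rightarrow> real"
  assumes "\<And>n j. j < n \<Longrightarrow> 0 \<le> \<alpha> n j" and "\<And>n. (\<Sum>j<n. \<alpha> n j) \<le> C" "0 \<le> C"
  shows "(\<Sum>j<n. \<Sum>i\<in>{j<..<n}. \<alpha> n i * \<alpha> i j) \<le> C\<^sup>2"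
proof -
  have "(\<Sum>j<n. \<Sum>i\<in>{j<..<n}. \<alpha> n i * \<alpha> i j) = (\<Sum>i<n. \<Sum>j<i. \<alpha> n i * \<alpha> i j)"
    by (subst (1 2) sum.Sigma) (auto intro!: sum.reindex_bij_witness[of _ prod.swap prod.swap])
  also have "\<dots> = (\<Sum>i<n. \<alpha> n i * (\<Sum>j<i. \<alpha> i j))" by (simp add: sum_distrib_left)
  also have "\<dots> \<le> (\<Sum>i<n. \<alpha> n i * C)"
    using assms by (intro sum_mono mult_left_mono) auto
  also have "\<dots> = (\<Sum>i<n. \<alpha> n i) * C" by (simp add: sum_distrib_right)
  also have "\<dots> \<le> C * C" using assms by (intro mult_right_mono) auto
  finally show ?thesis by (simp add: power2_eq_square)
qed

lemma sum_iterated_kernel_column_le: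
  fixes \<beta> :: "nat \<Rightarrow> nat \<Rightarrow> real"
  assumes "\<And>j n. m \<le> j \<Longrightarrow> j < n \<Longrightarrow> 0 \<le> \<beta> n j"
    and "\<And>j N. m \<le> j \<Longrightarrow> (\<Sum>n\<in>{j<..<N}. \<beta> n j) \<le> C" and "0 \<le> C" "m \<le> j"
  shows "(\<Sum>n\<in>{j<..<N}. \<Sum>i\<in>{j<..<n}. \<beta> n i * \<beta> i j) \<le> C\<^sup>2"
proof -
  have "(\<Sum>n\<in>{j<..<N}. \<Sum>i\<in>{j<..<n}. \<beta> n i * \<beta> i j) = (\<Sum>i\<in>{j<..<N}. \<Sum>n\<in>{i<..<N}. \<beta> n i * \<beta> i j)"
    by (subst (1 2) sum.Sigma) (auto intro!: sum.reindex_bij_witness[of _ prod.swap prod.swap])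
  also have "\<dots> = (\<Sum>i\<in>{j<..<N}. (\<Sum>n\<in>{i<..<N}. \<beta> n i) * \<beta> i j)" by (simp add: sum_distrib_right)
  also have "\<dots> \<le> (\<Sum>i\<in>{j<..<N}. C * \<beta> i j)"
    using assms by (intro sum_mono mult_right_mono) auto
  also have "\<dots> = C * (\<Sum>i\<in>{j<..<N}. \<beta> i j)" by (simp add: sum_distrib_left)
  also have "\<dots> \<le> C * C" using assms by (intro mult_left_mono) auto
  finally show ?thesis by (simp add: power2_eq_square)
qed

text \<open>An index with label \<open>l\<close> has the weight \<open>c l\<close>, which may be large, but occurs only beyond
  \<open>N l\<close>, where the tail of the series absorbs the weight. Grouping by label leaves a geometric series.\<close>

lemma summable_labelled_weights:
  fixes a c :: "nat \<Rightarrow> real" and lab :: "nat \<Rightarrow> nat"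
  assumes "summable a" "\<And>j. 0 \<le> a j" "\<And>l. 0 \<le> c l"
    and start: "\<And>j. j \<in> S \<Longrightarrow> N (lab j) \<le> j"
    and tail: "\<And>l. c l * (\<Sum>j. a (j + N l)) \<le> (1/2) ^ l"
  shows "summable (\<lambda>j. if j \<in> S then c (lab j) * a j else 0)"
proof (rule summableI_nonneg_bounded)
  fix J
  define T where "T = {j \<in> {..<J}. j \<in> S}"
  have "(\<Sum>j<J. if j \<in> S then c (lab j) * a j else 0) = (\<Sum>j\<in>T. c (lab j) * a j)"
    unfolding T_def by (rule sum.inter_filter[symmetric]) simp
  also have "\<dots> = (\<Sum>l\<in>lab ` T. \<Sum>j\<in>{j\<in>T. lab j = l}. c (lab j) * a j)"
    by (rule sum.image_gen) (simp add: T_def)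
  also have "\<dots> \<le> (\<Sum>l\<in>lab ` T. (1/2) ^ l)"
  proof (rule sum_mono)
    fix l
    have "(\<Sum>j\<in>{j\<in>T. lab j = l}. a j) \<le> (\<Sum>j\<in>{N l..<N l + J}. a j)"
      using start assms(2) by (intro sum_mono2) (force simp: T_def)+
    also have "\<dots> = (\<Sum>j<J. a (j + N l))"
      using sum.shift_bounds_nat_ivl[of a 0 "N l" J] by (simp add: add.commute atLeast0LessThan)
    also have "\<dots> \<le> (\<Sum>j. a (j + N l))"
      using assms(1,2) by (intro sum_le_suminf) (auto simp: summable_iff_shift)
    finally have "c l * (\<Sum>j\<in>{j\<in>T. lab j = l}. a j) \<le> (1/2) ^ l"
      using tail[of l] assms(3)[of l] by (meson mult_left_mono order_trans)
    then show "(\<Sum>j\<in>{j\<in>T. lab j = l}. c (lab j) * a j) \<le> (1/2) ^ l"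
      by (simp add: sum_distrib_left)
  qed
  also have "\<dots> \<le> (\<Sum>l. (1/2) ^ l)"
    by (intro sum_le_suminf) (auto simp: T_def summable_geometric)
  finally show "(\<Sum>j<J. if j \<in> S then c (lab j) * a j else 0) \<le> (\<Sum>l. (1/2) ^ l)" .
qed (use assms in auto)

section \<open>Superpositions that nearly interpolate\<close>

text \<open>The function \<open>f\<close> has the density \<open>\<Sum>j\<ge>1. G j / \<Phi> j\<close> on the circle of radius \<open>R3\<close>. In
  \<open>\<Phi> n (D) f\<close> the \<open>j\<close>-th term has density \<open>G j \<Phi> n / \<Phi> j\<close>, which for \<open>j = n\<close> is \<open>G n\<close>. For
  \<open>j \<noteq> n\<close> the hypothesis that \<open>s\<close> times the size of \<open>G j\<close> is at most the gap \<open>|n - j| - 1\<close> turns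
  the first moment bound \<open>C\<^sup>2\<close> into the error \<open>C\<^sup>2 / s\<close>, once on the circle of radius \<open>R1\<close> for
  \<open>j < n\<close> and once on that of radius \<open>R2\<close> for \<open>j > n\<close>. A vanishing \<open>G j\<close> may have size
  \<open>w j = 0\<close> and then satisfies the gap condition at every distance.\<close>

lemma superposition_nearly_interpolates:
  fixes \<Phi> G :: "nat \<Rightarrow> complex \<Rightarrow> complex" and \<alpha> \<beta> :: "nat \<Rightarrow> nat \<Rightarrow> real"
    and w a :: "nat \<Rightarrow> real"
  assumes exp_type: "\<And>n. 1 \<le> n \<Longrightarrow> exponential_type (\<Phi> n)"
    and R_pos: "0 < R1" "0 < R2" "0 < R3"
    and alpha_nonneg: "\<And>n j. j < n \<Longrightarrow> 0 \<le> \<alpha> n j"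
    and beta_nonneg: "\<And>n j. 1 \<le> j \<Longrightarrow> j < n \<Longrightarrow> 0 \<le> \<beta> n j"
    and alpha_sum: "\<And>n. (\<Sum>j<n. \<alpha> n j) \<le> C"
    and beta_sum: "\<And>j N. 1 \<le> j \<Longrightarrow> (\<Sum>n\<in>{j<..<N}. \<beta> n j) \<le> C"
    and nonzero: "\<And>n t. 1 \<le> n \<Longrightarrow> t \<in> annulus {R1, R2, R3} \<Longrightarrow> \<Phi> n t \<noteq> 0"
    and alpha: "\<And>n j t. j < n \<Longrightarrow> norm t = R1 \<Longrightarrow> norm (\<Phi> n t) \<le> \<alpha> n j * norm (\<Phi> j t)"
    and beta: "\<And>n j t. 1 \<le> j \<Longrightarrow> j < n \<Longrightarrow> norm t = R2 \<Longrightarrow> norm (\<Phi> j t) \<le> \<beta> n j * norm (\<Phi> n t)"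
    and a: "\<And>j t. 1 \<le> j \<Longrightarrow> norm t = R3 \<Longrightarrow> 1 / norm (\<Phi> j t) \<le> a j"
    and G: "\<And>j. G j holomorphic_on - {0}"
    and w: "\<And>j t. norm t \<in> {R1, R2, R3} \<Longrightarrow> norm (G j t) \<le> w j"
    and wa: "summable (\<lambda>j. w j * a j)"
  obtains f where "f \<in> entire_functions"
    "\<And>n s z. 1 \<le> n \<Longrightarrow> 0 < s \<Longrightarrow> (\<And>j. 1 \<le> j \<Longrightarrow> j \<noteq> n \<Longrightarrow> s * w j \<le> \<bar>real n - real j\<bar> - 1) \<Longrightarrow>
       norm (diff_op (\<Phi> n) f z - exp_superposition R3 (G n) z)
         \<le> (R1 * exp (R1 * norm z) + R2 * exp (R2 * norm z)) * C\<^sup>2 / s"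
proof -
  have C: "0 \<le> C" using alpha_sum[of 0] by simp
  have w_nonneg: "0 \<le> w j" for j
    by (rule order_trans[OF norm_ge_zero w[of "of_real R1"]]) (use R_pos in simp)
  have hol: "\<Phi> j holomorphic_on S" if "1 \<le> j" for j S
    using exp_type[OF that] by (auto simp: exponential_type_def entire_functions_def intro: holomorphic_on_subset)
  \<comment> \<open>An open neighbourhood of the closed annulus on which \<open>G j / \<Phi> j\<close> is holomorphic, as needed
    for the change of radius.\<close>
  define D where "D = (\<lambda>j. {t. t \<noteq> 0 \<and> \<Phi> j t \<noteq> 0})"
  have D_open: "open (D j)" if "1 \<le> j" for j
    unfolding D_def using holomorphic_on_imp_continuous_on[OF hol[OF that]]
    by (intro open_Collect_conj open_Collect_neq) auto
  have in_D: "t \<in> D j" if "1 \<le> j" "Min {R1, R2, R3} \<le> norm t" "norm t \<le> Max {R1, R2, R3}" for j t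
    using nonzero[OF that(1), of t] that R_pos by (auto simp: D_def annulus_def)
  define h where "h = (\<lambda>j t. G j t / \<Phi> j t)"
  have h_hol: "h j holomorphic_on D j" if "1 \<le> j" for j
    unfolding h_def using hol[OF that]
    by (intro holomorphic_on_divide holomorphic_on_subset[OF G]) (auto simp: D_def)
  have h_cont: "continuous_on (sphere 0 R) (h j)" if "1 \<le> j" "R \<in> {R1, R2, R3}" for j R
    using that by (intro holomorphic_on_imp_continuous_on holomorphic_on_subset[OF h_hol] subsetI in_D) auto
  have h_bound: "norm (h j t) \<le> w j * a j" if "1 \<le> j" "norm t = R3" for j t
    using mult_mono[OF w[of t j] a[OF that]] that w_nonneg by (simp add: h_def norm_divide)
  have lim: "uniform_limit (sphere 0 R3) (\<lambda>J t. \<Sum>j<J. h (Suc j) t) (\<lambda>t. \<Sum>j. h (Suc j) t) sequentially"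
    using wa h_bound by (intro Weierstrass_m_test[of _ _ "\<lambda>j. w (Suc j) * a (Suc j)"])
      (auto simp: summable_Suc_iff[of "\<lambda>j. w j * a j"])
  then have H_cont: "continuous_on (sphere 0 R3) (\<lambda>t. \<Sum>j. h (Suc j) t)"
    by (intro uniform_limit_theorem[OF _ lim] always_eventually allI continuous_on_sum h_cont) auto
  define f where "f = exp_superposition R3 (\<lambda>t. \<Sum>j. h (Suc j) t)"
  show thesis
  proof
    show "f \<in> entire_functions"
      unfolding f_def using R_pos(3) H_cont by (rule exp_superposition_entire)
  next
    fix n z and s :: real
    assume n: "1 \<le> n" and s: "0 < s"
      and gap: "\<And>j. 1 \<le> j \<Longrightarrow> j \<noteq> n \<Longrightarrow> s * w j \<le> \<bar>real n - real j\<bar> - 1"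
    define T where "T = (\<lambda>j. exp_superposition R3 (\<lambda>t. \<Phi> n t * h j t) z)"
    have n_cont: "continuous_on (sphere 0 R) (\<Phi> n)" for R
      by (rule holomorphic_on_imp_continuous_on[OF hol[OF n]])
    have "bounded (\<Phi> n ` sphere 0 R3)" "bounded ((\<lambda>t. \<Sum>j. h (Suc j) t) ` sphere 0 R3)"
      using n_cont H_cont by (auto intro!: compact_imp_bounded compact_continuous_image)
    then have "uniform_limit (sphere 0 R3) (\<lambda>J t. \<Phi> n t * (\<Sum>j<J. h (Suc j) t))
        (\<lambda>t. \<Phi> n t * (\<Sum>j. h (Suc j) t)) sequentially"
      by (intro uniform_lim_mult uniform_limit_const lim)
    then have "(\<lambda>J. exp_superposition R3 (\<lambda>t. \<Phi> n t * (\<Sum>j<J. h (Suc j) t)) z)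
        \<longlonglongrightarrow> exp_superposition R3 (\<lambda>t. \<Phi> n t * (\<Sum>j. h (Suc j) t)) z"
      using R_pos by (intro exp_superposition_uniform_limit continuous_intros h_cont n_cont) auto
    moreover have "exp_superposition R3 (\<lambda>t. \<Phi> n t * (\<Sum>j<J. h (Suc j) t)) z = (\<Sum>j=1..J. T j)" for J
    proof -
      have "exp_superposition R3 (\<lambda>t. \<Sum>j<J. \<Phi> n t * h (Suc j) t) z = (\<Sum>j<J. T (Suc j))"
        unfolding T_def using R_pos
        by (intro exp_superposition_sum continuous_intros h_cont n_cont) auto
      then show ?thesis by (simp add: sum_distrib_left sum.atLeast1_atMost_eq)
    qed
    moreover have "diff_op (\<Phi> n) f = exp_superposition R3 (\<lambda>t. \<Phi> n t * (\<Sum>j. h (Suc j) t))"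
      unfolding f_def by (intro diff_op_exp_superposition exp_type n R_pos H_cont)
    ultimately have series: "(\<lambda>J. \<Sum>j=1..J. T j) \<longlonglongrightarrow> diff_op (\<Phi> n) f z" by simp

    have T_n: "T n = exp_superposition R3 (G n) z"
      unfolding T_def
    proof (intro fun_cong[OF exp_superposition_cong] R_pos)
      fix t :: complex assume "norm t = R3"
      then have "\<Phi> n t \<noteq> 0" using in_D[OF n, of t] by (simp add: D_def)
      then show "\<Phi> n t * h n t = G n t" by (simp add: h_def)
    qed
    have T_le: "norm (T j) \<le> R * exp (R * norm z) * (A / s)"
      if R: "R \<in> {R1, R2}" and j: "1 \<le> j" "j \<noteq> n"
        and A: "\<And>t. norm t = R \<Longrightarrow> (\<bar>real n - real j\<bar> - 1) * norm (\<Phi> n t) \<le> A * norm (\<Phi> j t)"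
      for R j A
    proof -
      have Rpos: "0 < R" using R R_pos by auto
      have "exp_superposition R3 (\<lambda>t. \<Phi> n t * h j t) = exp_superposition R (\<lambda>t. \<Phi> n t * h j t)"
      proof (rule exp_superposition_change_radius[OF R_pos(3) Rpos D_open[OF j(1)]])
        show "{t. min R3 R \<le> norm t \<and> norm t \<le> max R3 R} \<subseteq> D j"
          using R by (intro subsetI in_D j(1)) auto
      qed (intro holomorphic_on_mult hol n h_hol j)
      moreover have "norm (exp_superposition R (\<lambda>t. \<Phi> n t * h j t) z) \<le> R * exp (R * norm z) * (A / s)"
      proof (rule exp_superposition_bound[OF Rpos])
        show "continuous_on (sphere 0 R) (\<lambda>t. \<Phi> n t * h j t)"
          using R j by (intro continuous_intros n_cont h_cont) auto
      next
        fix t :: complex assume t: "norm t = R"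
        have "\<Phi> j t \<noteq> 0" using in_D[OF j(1), of t] t R by (auto simp: D_def min_le_iff_disj le_max_iff_disj)
        have "s * norm (G j t) * norm (\<Phi> n t) \<le> s * w j * norm (\<Phi> n t)"
          using w[of t j] t R s by (intro mult_left_mono mult_right_mono) auto
        also have "\<dots> \<le> (\<bar>real n - real j\<bar> - 1) * norm (\<Phi> n t)"
          using gap[OF j] by (intro mult_right_mono) auto
        also have "\<dots> \<le> A * norm (\<Phi> j t)" using A[OF t] .
        finally show "norm (\<Phi> n t * h j t) \<le> A / s"
          using s \<open>\<Phi> j t \<noteq> 0\<close> by (simp add: h_def norm_mult norm_divide field_simps)
      qed
      ultimately show ?thesis by (simp add: T_def)
    qed
    define K1 K2 where "K1 = R1 * exp (R1 * norm z)" and "K2 = R2 * exp (R2 * norm z)"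
    have K: "0 \<le> K1" "0 \<le> K2" using R_pos by (auto simp: K1_def K2_def)
    have below: "norm (\<Sum>j\<in>{1..<n}. T j) \<le> K1 * (C\<^sup>2 / s)"
    proof -
      define A where "A = (\<lambda>j. \<Sum>i\<in>{j<..<n}. \<alpha> n i * \<alpha> i j)"
      have "norm (T j) \<le> K1 * (A j / s)" if j: "1 \<le> j" "j < n" for j
        unfolding K1_def
      proof (rule T_le)
        fix t :: complex assume t: "norm t = R1"
        have "real (card {j<..<n}) * norm (\<Phi> n t) \<le> A j * norm (\<Phi> j t)"
          unfolding A_def using alpha_nonneg alpha t
          by (intro card_mult_norm_le_of_chains[where y = "\<lambda>i. \<Phi> i t"]) auto
        moreover have "real (card {j<..<n}) = \<bar>real n - real j\<bar> - 1" using j by (simp add: of_nat_diff)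
        ultimately show "(\<bar>real n - real j\<bar> - 1) * norm (\<Phi> n t) \<le> A j * norm (\<Phi> j t)" by simp
      qed (use j in auto)
      then have "norm (\<Sum>j\<in>{1..<n}. T j) \<le> (\<Sum>j\<in>{1..<n}. K1 * (A j / s))"
        by (intro sum_norm_le) auto
      also have "\<dots> \<le> (\<Sum>j<n. K1 * (A j / s))"
        using s K unfolding A_def
        by (intro sum_mono2 mult_nonneg_nonneg divide_nonneg_pos sum_nonneg alpha_nonneg) auto
      also have "\<dots> = K1 * ((\<Sum>j<n. A j) / s)" by (simp add: sum_distrib_left sum_divide_distrib)
      also have "\<dots> \<le> K1 * (C\<^sup>2 / s)"
        unfolding A_def using s K C alpha_nonneg alpha_sum
        by (intro mult_left_mono divide_right_mono sum_iterated_kernel_le) auto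
      finally show ?thesis .
    qed
    have above: "norm (\<Sum>j\<in>{n<..<N}. T j) \<le> K2 * (C\<^sup>2 / s)" for N
    proof -
      define A where "A = (\<lambda>j. \<Sum>i\<in>{n<..<j}. \<beta> j i * \<beta> i n)"
      have "norm (T j) \<le> K2 * (A j / s)" if j: "n < j" for j
        unfolding K2_def
      proof (rule T_le)
        fix t :: complex assume t: "norm t = R2"
        have "real (card {n<..<j}) * norm (\<Phi> n t) \<le> (\<Sum>i\<in>{n<..<j}. \<beta> i n * \<beta> j i) * norm (\<Phi> j t)"
          using beta_nonneg beta t n
          by (intro card_mult_norm_le_of_chains[where y = "\<lambda>i. \<Phi> i t"]) auto
        moreover have "real (card {n<..<j}) = \<bar>real n - real j\<bar> - 1" using j by (simp add: of_nat_diff)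
        ultimately show "(\<bar>real n - real j\<bar> - 1) * norm (\<Phi> n t) \<le> A j * norm (\<Phi> j t)"
          by (simp add: A_def mult.commute)
      qed (use j n in auto)
      then have "norm (\<Sum>j\<in>{n<..<N}. T j) \<le> (\<Sum>j\<in>{n<..<N}. K2 * (A j / s))"
        by (intro sum_norm_le) auto
      also have "\<dots> = K2 * ((\<Sum>j\<in>{n<..<N}. A j) / s)" by (simp add: sum_distrib_left sum_divide_distrib)
      also have "\<dots> \<le> K2 * (C\<^sup>2 / s)"
        unfolding A_def using s K C beta_nonneg beta_sum n
        by (intro mult_left_mono divide_right_mono sum_iterated_kernel_column_le[where m = 1]) auto
      finally show ?thesis .
    qed
    have partial: "norm ((\<Sum>j=1..J. T j) - exp_superposition R3 (G n) z) \<le> (K1 + K2) * C\<^sup>2 / s"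
      if "n \<le> J" for J
    proof -
      have "{1..J} = insert n ({1..<n} \<union> {n<..<Suc J})" using n that by auto
      moreover have "{1..<n} \<inter> {n<..<Suc J} = {}" by auto
      ultimately have "(\<Sum>j=1..J. T j) = T n + ((\<Sum>j\<in>{1..<n}. T j) + (\<Sum>j\<in>{n<..<Suc J}. T j))"
        by (simp add: sum.union_disjoint del: One_nat_def)
      then have "norm ((\<Sum>j=1..J. T j) - exp_superposition R3 (G n) z)
          \<le> norm (\<Sum>j\<in>{1..<n}. T j) + norm (\<Sum>j\<in>{n<..<Suc J}. T j)"
        by (simp add: T_n norm_triangle_ineq)
      also have "\<dots> \<le> K1 * (C\<^sup>2 / s) + K2 * (C\<^sup>2 / s)" by (intro add_mono below above)
      finally show ?thesis by (simp add: algebra_simps add_divide_distrib)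
    qed
    have "norm (diff_op (\<Phi> n) f z - exp_superposition R3 (G n) z) \<le> (K1 + K2) * C\<^sup>2 / s"
    proof (rule Lim_norm_ubound)
      show "(\<lambda>J. (\<Sum>j=1..J. T j) - exp_superposition R3 (G n) z)
          \<longlonglongrightarrow> diff_op (\<Phi> n) f z - exp_superposition R3 (G n) z"
        by (intro tendsto_diff series tendsto_const)
      show "\<forall>\<^sub>F J in sequentially. norm ((\<Sum>j=1..J. T j) - exp_superposition R3 (G n) z)
          \<le> (K1 + K2) * C\<^sup>2 / s"
        using partial by (rule eventually_sequentiallyI)
    qed simp
    then show "norm (diff_op (\<Phi> n) f z - exp_superposition R3 (G n) z)
        \<le> (R1 * exp (R1 * norm z) + R2 * exp (R2 * norm z)) * C\<^sup>2 / s"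
      by (simp add: K1_def K2_def)
  qed
qed

section \<open>Frequent hypercyclicity\<close>

theorem theorem3p1:
  fixes \<Phi> :: "nat \<Rightarrow> complex \<Rightarrow> complex"
    and R1 R2 R3 :: real
    and \<alpha> \<beta> :: "nat \<Rightarrow> nat \<Rightarrow> real"
  assumes exp_type: "\<And>n. 1 \<le> n \<Longrightarrow> exponential_type (\<Phi> n)"
    and Phi_0: "\<Phi> 0 = (\<lambda>_. 1)"
    and R_pos: "0 < R1" "0 < R2" "0 < R3"
    and alpha_pos: "\<And>n j. j < n \<Longrightarrow> 0 < \<alpha> n j"
    and beta_pos: "\<And>n j. 1 \<le> j \<Longrightarrow> j < n \<Longrightarrow> 0 < \<beta> n j"
    and a1: "(SUP n\<in>{1..}. \<Sum>j<n. ennreal (\<alpha> n j)) < \<infinity>"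
    and a2: "(SUP j\<in>{1..}. \<Sum>\<^sub>\<infinity>n\<in>{j+1..}. ennreal (\<beta> n j)) < \<infinity>"
    and b: "\<And>n t. 1 \<le> n \<Longrightarrow> t \<in> annulus {R1, R2, R3} \<Longrightarrow> \<Phi> n t \<noteq> 0"
    and c: "\<And>n j t. j < n \<Longrightarrow> norm t = R1 \<Longrightarrow> norm (\<Phi> n t) \<le> \<alpha> n j * norm (\<Phi> j t)"
    and d: "\<And>n j t. 1 \<le> j \<Longrightarrow> j < n \<Longrightarrow> norm t = R2 \<Longrightarrow> norm (\<Phi> j t) \<le> \<beta> n j * norm (\<Phi> n t)"
    and e: "summable (\<lambda>n. 1 / (INF t\<in>sphere 0 R3. norm (\<Phi> (Suc n) t)))"
  shows "frequently_hypercyclic entire_topology (\<lambda>n. diff_op (\<Phi> n))"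
proof -
  obtain C1 where C1: "0 \<le> C1" "(SUP n\<in>{1..}. \<Sum>j<n. ennreal (\<alpha> n j)) = ennreal C1"
    using a1 unfolding infinity_ennreal_def less_top_ennreal by blast
  obtain C2 where C2: "0 \<le> C2" "(SUP j\<in>{1..}. \<Sum>\<^sub>\<infinity>n\<in>{j+1..}. ennreal (\<beta> n j)) = ennreal C2"
    using a2 unfolding infinity_ennreal_def less_top_ennreal by blast
  define C where "C = max C1 C2"
  have alpha_sum: "(\<Sum>j<n. \<alpha> n j) \<le> C" for n
  proof (cases "n = 0")
    case False
    then have "(\<Sum>j<n. ennreal (\<alpha> n j)) \<le> ennreal C1"
      unfolding C1(2)[symmetric] by (intro SUP_upper) auto
    then have "ennreal (\<Sum>j<n. \<alpha> n j) \<le> ennreal C1"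
      by (subst (asm) sum_ennreal) (auto intro: less_imp_le alpha_pos)
    then show ?thesis using C1(1) by (simp add: C_def ennreal_le_iff le_max_iff_disj)
  qed (simp add: C_def C1(1) le_max_iff_disj)
  have beta_sum: "(\<Sum>n\<in>{j<..<N}. \<beta> n j) \<le> C" if j: "1 \<le> j" for j N
  proof -
    have "(\<Sum>n\<in>{j<..<N}. ennreal (\<beta> n j)) = (\<Sum>\<^sub>\<infinity>n\<in>{j<..<N}. ennreal (\<beta> n j))"
      by simp
    also have "\<dots> \<le> (\<Sum>\<^sub>\<infinity>n\<in>{j+1..}. ennreal (\<beta> n j))"
      by (intro infsum_mono_neutral nonneg_summable_on_complete) auto
    also have "\<dots> \<le> ennreal C2"
      unfolding C2(2)[symmetric] using j by (intro SUP_upper) auto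
    finally have "ennreal (\<Sum>n\<in>{j<..<N}. \<beta> n j) \<le> ennreal C2"
      using less_imp_le[OF beta_pos[OF j]] by (subst (asm) sum_ennreal) auto
    then show ?thesis using C2(1) by (simp add: C_def ennreal_le_iff le_max_iff_disj)
  qed

  define a where "a = (\<lambda>j. 1 / (INF t\<in>sphere 0 R3. norm (\<Phi> j t)))"
  have sphere_ne: "sphere (0::complex) R3 \<noteq> {}" using R_pos by simp
  have inf_le: "(INF t\<in>sphere 0 R3. norm (\<Phi> j t)) \<le> norm (\<Phi> j t)" if "norm t = R3" for j t
    using that by (intro cINF_lower) (auto intro!: bdd_belowI2[of _ 0])
  have inf_pos: "0 < (INF t\<in>sphere 0 R3. norm (\<Phi> j t))" if j: "1 \<le> j" for j
  proof -
    have "continuous_on (sphere 0 R3) (\<lambda>t. norm (\<Phi> j t))"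
      using exp_type[OF j]
      by (auto simp: exponential_type_def entire_functions_def
          intro!: continuous_on_norm holomorphic_on_imp_continuous_on intro: holomorphic_on_subset)
    then obtain t0 where t0: "t0 \<in> sphere 0 R3" "\<And>t. t \<in> sphere 0 R3 \<Longrightarrow> norm (\<Phi> j t0) \<le> norm (\<Phi> j t)"
      using continuous_attains_inf[OF compact_sphere sphere_ne] by metis
    have "0 < norm (\<Phi> j t0)"
      using b[OF j, of t0] t0(1) by (simp add: annulus_def min_le_iff_disj le_max_iff_disj)
    also have "\<dots> \<le> (INF t\<in>sphere 0 R3. norm (\<Phi> j t))"
      using t0(2) sphere_ne by (intro cINF_greatest) auto
    finally show ?thesis .
  qed
  have a_bound: "1 / norm (\<Phi> j t) \<le> a j" if "1 \<le> j" "norm t = R3" for j t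
    unfolding a_def using inf_pos[OF that(1)] inf_le[OF that(2), of j]
    by (intro divide_left_mono) (auto intro!: mult_pos_pos)
  have a_nonneg: "0 \<le> a j" for j
    unfolding a_def using sphere_ne by (intro divide_nonneg_nonneg cINF_greatest) auto
  have a_summable: "summable a"
    using e summable_Suc_iff[of a] by (simp add: a_def)

  obtain Q :: "complex poly set" where Q: "countable Q" "Q \<noteq> {}"
    and Q_dense: "\<And>f K e. f \<in> entire_functions \<Longrightarrow> compact K \<Longrightarrow> 0 < e \<Longrightarrow>
       \<exists>P\<in>Q. \<forall>z\<in>K. dist (poly P z) (f z) < e"
    using countable_dense_polynomials by metis
  \<comment> \<open>Decoding \<open>l\<close> as a pair \<open>(i, k)\<close> repeats the \<open>k\<close>-th polynomial for every \<open>i\<close>, with the accuracy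
    \<open>1 / r l = 1 / (i + 1)\<close>.\<close>
  define P where "P = (\<lambda>l. from_nat_into Q (snd (prod_decode l)))"
  define r where "r = (\<lambda>l. real (Suc (fst (prod_decode l))))"
  have r_pos: "0 < r l" for l by (simp add: r_def)

  have "\<exists>c\<ge>0. \<forall>t. norm t \<in> {R1, R2, R3} \<longrightarrow> norm (borel_symbol (P l) t) \<le> c" for l
  proof -
    define S where "S = sphere (0::complex) R1 \<union> sphere 0 R2 \<union> sphere 0 R3"
    have "compact S" by (auto simp: S_def intro!: compact_Un)
    moreover have "continuous_on S (borel_symbol (P l))"
      using R_pos by (intro holomorphic_on_imp_continuous_on holomorphic_on_subset[OF borel_symbol_holomorphic])
        (auto simp: S_def)
    ultimately have "bounded (borel_symbol (P l) ` S)"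
      by (intro compact_imp_bounded compact_continuous_image)
    then obtain c where "\<And>t. t \<in> S \<Longrightarrow> norm (borel_symbol (P l) t) \<le> c"
      unfolding bounded_iff by blast
    then show ?thesis by (intro exI[of _ "max 0 c"]) (fastforce simp: S_def)
  qed
  then obtain c where c_nonneg: "\<And>l. 0 \<le> c l"
    and c_bound: "\<And>l t. norm t \<in> {R1, R2, R3} \<Longrightarrow> norm (borel_symbol (P l) t) \<le> c l"
    by metis

  \<comment> \<open>Sparseness of the \<open>l\<close>-th set: the first inequality makes the superposition converge. The second
    makes the separation \<open>N l + N m\<close> at least \<open>(r l)\<^sup>2 + (c m)\<^sup>2\<close>, and hence at least \<open>r l * c m\<close>.\<close>
  have "\<exists>M. \<forall>N\<ge>M. c l * (\<Sum>j. a (j + N)) \<le> (1/2) ^ l \<and> (r l)\<^sup>2 + (c l)\<^sup>2 \<le> real N" for l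
  proof -
    define \<epsilon> where "\<epsilon> = (1/2) ^ l / (c l + 1)"
    have "0 < \<epsilon>" using c_nonneg[of l] by (simp add: \<epsilon>_def)
    then obtain M1 where M1: "\<forall>N\<ge>M1. norm (\<Sum>j. a (j + N)) < \<epsilon>"
      using suminf_exist_split[OF _ a_summable] by blast
    obtain M2 where M2: "(r l)\<^sup>2 + (c l)\<^sup>2 \<le> real M2" using real_arch_simple by blast
    show ?thesis
    proof (intro exI[of _ "max M1 M2"] allI impI conjI)
      fix N assume N: "max M1 M2 \<le> N"
      have "c l * (\<Sum>j. a (j + N)) \<le> c l * \<epsilon>"
        using M1 N c_nonneg[of l] by (intro mult_left_mono) (force dest: spec[of _ N])+
      also have "\<dots> \<le> (c l + 1) * \<epsilon>" using \<open>0 < \<epsilon>\<close> by (intro mult_right_mono) auto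
      also have "\<dots> = (1/2) ^ l" using c_nonneg[of l] by (simp add: \<epsilon>_def)
      finally show "c l * (\<Sum>j. a (j + N)) \<le> (1/2) ^ l" .
      show "(r l)\<^sup>2 + (c l)\<^sup>2 \<le> real N" using M2 N by linarith
    qed
  qed
  then obtain M where M: "\<And>l N. M l \<le> N \<Longrightarrow> c l * (\<Sum>j. a (j + N)) \<le> (1/2) ^ l"
    "\<And>l N. M l \<le> N \<Longrightarrow> (r l)\<^sup>2 + (c l)\<^sup>2 \<le> real N" by metis
  \<comment> \<open>Distinct labels must receive distinct sets \<open>B (N l)\<close>, so \<open>N\<close> has to be injective.\<close>
  define N where "N = (\<lambda>l. \<Sum>i\<le>l. M i + 1)"
  have N_ge: "M l \<le> N l" for l
    using member_le_sum[of l "{..l}" "\<lambda>i. M i + 1"] by (simp add: N_def)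
  have "strict_mono N" by (rule strict_monoI_Suc) (simp add: N_def)
  then have N_inj: "N l \<noteq> N m" if "l \<noteq> m" for l m using that by (simp add: strict_mono_eq)

  obtain B :: "nat \<Rightarrow> nat set" where
    B_dens: "\<And>i. 0 < lower_density (B i)"
    and B_gt: "\<And>i n. n \<in> B i \<Longrightarrow> i < n"
    and B_sep: "\<And>i j m n. m \<in> B i \<Longrightarrow> n \<in> B j \<Longrightarrow> i \<noteq> j \<or> m \<noteq> n \<Longrightarrow>
      int (i + j + 2) \<le> \<bar>int m - int n\<bar>"
    using separated_sets_of_positive_lower_density by blast
  define S where "S = (\<Union>l. B (N l))"
  define lab where "lab = (\<lambda>j. SOME l. j \<in> B (N l))"
  have lab: "j \<in> B (N (lab j))" if "j \<in> S" for j
    using that unfolding lab_def S_def by (auto intro: someI)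
  have lab_eq: "lab j = l" if "j \<in> B (N l)" for j l
  proof (rule ccontr)
    assume "lab j \<noteq> l"
    moreover have "j \<in> B (N (lab j))" using that by (intro lab) (auto simp: S_def)
    ultimately show False using B_sep[OF _ that, of j] N_inj by fastforce
  qed

  define G where "G = (\<lambda>j. if j \<in> S then borel_symbol (P (lab j)) else (\<lambda>_. 0))"
  define w where "w = (\<lambda>j. if j \<in> S then c (lab j) else 0)"
  have "summable (\<lambda>j. if j \<in> S then c (lab j) * a j else 0)"
    using a_summable a_nonneg c_nonneg
  proof (rule summable_labelled_weights)
    show "N (lab j) \<le> j" if "j \<in> S" for j using B_gt[OF lab[OF that]] by simp
    show "c l * (\<Sum>j. a (j + N l)) \<le> (1/2) ^ l" for l using M(1)[OF N_ge] .
  qed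
  moreover have "(\<lambda>j. w j * a j) = (\<lambda>j. if j \<in> S then c (lab j) * a j else 0)"
    by (auto simp: w_def)
  ultimately have wa: "summable (\<lambda>j. w j * a j)" by simp
  have "G j holomorphic_on - {0}" for j
    by (simp add: G_def borel_symbol_holomorphic)
  moreover have "norm (G j t) \<le> w j" if "norm t \<in> {R1, R2, R3}" for j t
    using c_bound[OF that] by (simp add: G_def w_def)
  ultimately obtain f where f: "f \<in> entire_functions"
    and f_close: "\<And>n s z. 1 \<le> n \<Longrightarrow> 0 < s \<Longrightarrow>
       (\<And>j. 1 \<le> j \<Longrightarrow> j \<noteq> n \<Longrightarrow> s * w j \<le> \<bar>real n - real j\<bar> - 1) \<Longrightarrow>
       norm (diff_op (\<Phi> n) f z - exp_superposition R3 (G n) z)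
         \<le> (R1 * exp (R1 * norm z) + R2 * exp (R2 * norm z)) * C\<^sup>2 / s"
    using superposition_nearly_interpolates[of \<Phi> R1 R2 R3 \<alpha> \<beta> C a G w,
        OF exp_type R_pos less_imp_le[OF alpha_pos] less_imp_le[OF beta_pos] alpha_sum beta_sum b c d a_bound _ _ wa]
    by blast

  have gap: "r l * w j \<le> \<bar>real n - real j\<bar> - 1" if n: "n \<in> B (N l)" and ne: "j \<noteq> n" for n l j
  proof (cases "j \<in> S")
    case True
    define m where "m = lab j"
    have "int (N l + N m + 2) \<le> \<bar>int n - int j\<bar>"
      using B_sep[OF n lab[OF True]] ne by (simp add: m_def)
    then have "real (N l) + real (N m) + 2 \<le> \<bar>real n - real j\<bar>" by linarith
    moreover have "(r l)\<^sup>2 \<le> real (N l)" "(c m)\<^sup>2 \<le> real (N m)"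
      using M(2)[OF N_ge, of l] M(2)[OF N_ge, of m] zero_le_power2[of "c l"] zero_le_power2[of "r m"]
      by linarith+
    moreover have "2 * (r l * c m) \<le> (r l)\<^sup>2 + (c m)\<^sup>2"
      using sum_squares_bound[of "r l" "c m"] by (simp add: mult.assoc)
    moreover have "0 \<le> r l * c m" using r_pos[of l] c_nonneg by simp
    ultimately show ?thesis using True by (simp add: w_def m_def)
  next
    case False
    then show ?thesis using ne by (simp add: w_def)
  qed

  show ?thesis
    unfolding frequently_hypercyclic_def topspace_entire_topology
  proof (intro bexI[OF _ f] allI impI)
    fix U assume U: "openin entire_topology U \<and> U \<noteq> {}"
    then obtain u where u: "u \<in> U" "u \<in> entire_functions"
      unfolding openin_entire_topology by blast
    obtain K \<epsilon> where K: "compact K" "0 < \<epsilon>"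
      and KU: "{g \<in> entire_functions. \<forall>z\<in>K. dist (g z) (u z) < \<epsilon>} \<subseteq> U"
      using U u unfolding openin_entire_topology by blast
    obtain \<rho> where \<rho>: "\<And>z. z \<in> K \<Longrightarrow> norm z \<le> \<rho>"
      using compact_imp_bounded[OF K(1)] bounded_iff by blast
    obtain p where p: "p \<in> Q" "\<And>z. z \<in> K \<Longrightarrow> dist (poly p z) (u z) < \<epsilon> / 2"
      using Q_dense[OF u(2) K(1), of "\<epsilon> / 2"] K(2) by auto
    obtain k where k: "from_nat_into Q k = p" using from_nat_into_surj[OF Q(1) p(1)] by blast
    define E where "E = (R1 * exp (R1 * \<rho>) + R2 * exp (R2 * \<rho>)) * C\<^sup>2"
    obtain i where i: "E / (\<epsilon> / 2) < real i" using reals_Archimedean2 by blast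
    define l where "l = prod_encode (i, k)"
    have P_l: "P l = p" and r_l: "r l = real (Suc i)" by (simp_all add: P_def r_def l_def k)
    have "E < \<epsilon> / 2 * r l" using i K(2) by (simp add: r_l field_simps)
    then have E: "E / r l < \<epsilon> / 2" using r_pos[of l] by (simp add: divide_simps mult.commute)
    have "B (N l) \<subseteq> {n. 1 \<le> n \<and> diff_op (\<Phi> n) f \<in> U}"
    proof
      fix n assume n: "n \<in> B (N l)"
      then have n1: "1 \<le> n" using B_gt[OF n] by simp
      have "exp_superposition R3 (G n) = poly p"
        using n lab_eq[OF n] R_pos by (auto simp: G_def S_def P_l exp_superposition_borel_symbol)
      then have close: "norm (diff_op (\<Phi> n) f z - poly p z)
          \<le> (R1 * exp (R1 * norm z) + R2 * exp (R2 * norm z)) * C\<^sup>2 / r l" for z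
        using f_close[OF n1 r_pos[of l] gap[OF n], of z] by simp
      have "dist (diff_op (\<Phi> n) f z) (u z) < \<epsilon>" if z: "z \<in> K" for z
      proof -
        have "(R1 * exp (R1 * norm z) + R2 * exp (R2 * norm z)) * C\<^sup>2 / r l \<le> E / r l"
          unfolding E_def using \<rho>[OF z] R_pos r_pos[of l]
          by (intro divide_right_mono mult_right_mono add_mono mult_left_mono) auto
        then have "dist (diff_op (\<Phi> n) f z) (poly p z) < \<epsilon> / 2"
          using close[of z] E unfolding dist_norm by linarith
        then show ?thesis using p(2)[OF z] by (metis dist_commute dist_triangle_half_l)
      qed
      then have "diff_op (\<Phi> n) f \<in> U"
        using KU diff_op_entire[OF exp_type[OF n1] f] by blast
      then show "n \<in> {n. 1 \<le> n \<and> diff_op (\<Phi> n) f \<in> U}" using n1 by simp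
    qed
    then show "0 < lower_density {n. 1 \<le> n \<and> diff_op (\<Phi> n) f \<in> U}"
      using B_dens less_le_trans lower_density_mono by blast
  qed
qed

end
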